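(* Suppose $f,g\colon A\to B$ are two morphisms of $A_\infty$-algebras over a field $\mathbb{K}$ that are homotopic through $\eta=\{\eta_n\}$. Let $\mathbf{a}\in\mathrm{Mat}^{(m+1)}_+(A)$ be a defining system of $\alpha_1,\dots,\alpha_m\in\mathrm{H}(A)$, where $m\ge2$. Then $F_{\mathbf{a}}(\mathbf{a})$ and $G_{\mathbf{a}}(\mathbf{a})$ are two equivalent defining systems of $(f_1)_*\alpha_i=(g_1)_*\alpha_i\in\mathrm{H}(B)$ ($1\le i\le m$) and hence define the same Massey product, i.e. $[\mu(F_{\mathbf{a}}(\mathbf{a}))]=[\mu(G_{\mathbf{a}}(\mathbf{a}))]\in\mathrm{H}(B)$.
   Context: $A_\infty$-algebra: a $\mathbb{Z}$- or $\mathbb{Z}_2$-graded $\mathbb{K}$-vector space $A$ with graded multilinear maps $b_n\colon A^{\otimes n}\to A$ ($n\ge1$) of degree $1$ such that for each $n\ge1$, $\sum_{r,t\ge0,\,s\ge1,\,r+s+t=n}b_{r+1+t}\circ(1^{\otimes r}\otimes b_s\otimes1^{\otimes t})=0$ (Koszul sign rule $(f\otimes g)(x\otimes y)=(-1)^{|g||x|}f(x)\otimes g(y)$). $\mathrm{H}(A)$ is the cohomology of $(A,b_1)$. A bar denotes $\bar a=(-1)^{|a|}a$ for homogeneous $a$, extended linearly and entrywise to matrices. A morphism $f\colon A\to B$ is a family of multilinear maps $f_n\colon A^{\otimes n}\to B$ ($n\ge1$) of degree $0$ with, for each $n\ge1$, $\sum_{r,t\ge0,\,s\ge1,\,r+s+t=n}f_{r+1+t}\circ(1^{\otimes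 r}\otimes b^A_s\otimes1^{\otimes t})=\sum_{i_1+\cdots+i_r=n,\,i_j>0}b^B_r\circ(f_{i_1}\otimes\cdots\otimes f_{i_r})$. Morphisms $f,g$ are homotopic through multilinear maps $\eta_n\colon A^{\otimes n}\to B$ ($n\ge1$) of degree $-1$ if for each $n\ge1$ $$g_n-f_n=\sum b^B_{r+1+t}\circ(g_{i_1}\otimes\cdots\otimes g_{i_r}\otimes\eta_s\otimes f_{j_1}\otimes\cdots\otimes f_{j_t})+\sum\eta_{r+1+t}\circ(1^{\otimes r}\otimes b^A_s\otimes1^{\otimes t}),$$ the first sum over $r,t\ge0$, $s\ge1$, $i_1,\dots,i_r,j_1,\dots,j_t>0$ with $i_1+\cdots+i_r+s+j_1+\cdots+j_t=n$, the second over $r,t\ge0$, $s\ge1$, $r+s+t=n$. $\mathrm{Mat}^{(m+1)}_+(A)$ is the space of strictly upper-triangular matrices $\mathbf{a}=(a_{ij})_{0\le i,j\le m}$ with entries in $A$. The product $\odot$ of matrices is $(\mathbf{a}\odot\mathbf{b})_{ij}=\sum_ka_{ik}\otimes b_{kj}$ (no signs); $b_n$, $f_n$, $g_n$ act component-wise on matrices with entries in $A^{\otimes n}$. For $\mathbf{a}\in\mathrm{Mat}^{(m+1)}_+(A)$: $\partial_{\mathbf{a}}\mathbf{a}=\sum_{n\ge1}b_n(\mathbf{a}^{\odot n})$, $F_{\mathbf{a}}(\mathbf{a})=\sum_{n\ge1}f_n(\mathbf{a}^{\odot n})$, $G_{\mathbf{a}}(\mathbf{a})=\sum_{n\ge1}g_n(\mathbf{a}^{\odot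 n})$, where $\mathbf{a}^{\odot n}=\underbrace{\mathbf{a}\odot\cdots\odot\mathbf{a}}_n$ (finite sums). $\mathbf{a}\approx\mathbf{a}'$ means $a_{ij}=a'_{ij}$ for all $(i,j)\ne(0,m)$. For $m\ge2$, $\mathbf{a}$ is a defining system for $\alpha_1,\dots,\alpha_m\in\mathrm{H}(A)$ if $\partial_{\mathbf{a}}\mathbf{a}\approx0$ and each $\alpha_i$ is represented by the (then closed) element $a_{i-1,i}$; put $\mu(\mathbf{a})=(\partial_{\mathbf{a}}\mathbf{a})_{0m}$, which is $b_1$-closed, and call $[\mu(\mathbf{a})]$ the Massey product through the defining system $\mathbf{a}$. Two defining systems $\mathbf{a},\mathbf{a}'$ of the same classes are equivalent if there is a strictly upper-triangular $\mathbf{c}$ such that $\mathbf{a}'-\mathbf{a}\approx\sum_{r,t\ge0}b_{r+1+t}(\overline{\mathbf{a}'}^{\odot r}\odot\mathbf{c}\odot\mathbf{a}^{\odot t})$. *)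

theory Defs
  imports "Jordan_Normal_Form.Matrix" "HOL-Library.Multiset" "HOL-Library.Z2"
begin

section \<open>Graded vector spaces\<close>

text \<open>
  The degrees range over a type of class \<^class>\<open>ring_parity\<close>: taking it to be \<^typ>\<open>int\<close> gives
  $\mathbb{Z}$-gradings, taking it to be \<^typ>\<open>bit\<close> (the field with two elements) gives
  $\mathbb{Z}_2$-gradings.  In the latter case \<open>-1 = 1\<close> and \<open>even d\<close> means \<open>d = 0\<close>.
\<close>

definition is_decomposition :: "('d \<Rightarrow> 'a::ab_group_add set) \<Rightarrow> 'a \<Rightarrow> ('d \<Rightarrow> 'a) \<Rightarrow> bool" where
  "is_decomposition gr x c \<longleftrightarrow>
     (\<forall>d. c d \<in> gr d) \<and> finite {d. c d \<noteq> 0} \<and> x = (\<Sum>d | c d \<noteq> 0. c d)"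

locale graded_vector_space = vector_space scale
  for scale :: "'k::field \<Rightarrow> 'a::ab_group_add \<Rightarrow> 'a" +
  fixes gr :: "'d::ring_parity \<Rightarrow> 'a set"
  assumes subspace_gr: "subspace (gr d)"
    and ex1_decomposition: "\<exists>!c. is_decomposition gr x c"

definition sgn_by :: "'d::ring_parity \<Rightarrow> 'a::ab_group_add \<Rightarrow> 'a" where
  "sgn_by d x = (if even d then x else - x)"

definition bar :: "('d::ring_parity \<Rightarrow> 'a::ab_group_add set) \<Rightarrow> 'a \<Rightarrow> 'a" where
  "bar gr x = (let c = (THE c. is_decomposition gr x c) in \<Sum>d | c d \<noteq> 0. sgn_by d (c d))"

text \<open>
  A family of multilinear maps $h_n\colon A^{\otimes n}\to B$, $n\ge1$, is encoded as a single
  function on lists: $h_n(x_1,\dots,x_n)$ is \<open>h [x\<^sub>1, \<dots>, x\<^sub>n]\<close>.  The value at the empty list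
  is never used.
\<close>

definition multilinear ::
  "('k::field \<Rightarrow> 'a::ab_group_add \<Rightarrow> 'a) \<Rightarrow> ('k \<Rightarrow> 'b::ab_group_add \<Rightarrow> 'b) \<Rightarrow> ('a list \<Rightarrow> 'b) \<Rightarrow> bool" where
  "multilinear sA sB h \<longleftrightarrow> (\<forall>us ws. Vector_Spaces.linear sA sB (\<lambda>x. h (us @ x # ws)))"

definition homogeneous :: "('d \<Rightarrow> 'a set) \<Rightarrow> 'd list \<Rightarrow> 'a list \<Rightarrow> bool" where
  "homogeneous gr ds xs \<longleftrightarrow> list_all2 (\<lambda>d x. x \<in> gr d) ds xs"

definition has_degree ::
  "('d::ring_parity \<Rightarrow> 'a set) \<Rightarrow> ('d \<Rightarrow> 'b set) \<Rightarrow> 'd \<Rightarrow> ('a list \<Rightarrow> 'b) \<Rightarrow> bool" where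
  "has_degree gA gB p h \<longleftrightarrow>
     (\<forall>ds xs. xs \<noteq> [] \<longrightarrow> homogeneous gA ds xs \<longrightarrow> h xs \<in> gB (sum_list ds + p))"

section \<open>$A_\infty$-algebras, morphisms and homotopies\<close>

text \<open>
  The structure relations are identities between multilinear maps; they are stated on
  homogeneous elements \<open>xs\<close> of degrees \<open>ds\<close>, where the Koszul sign rule applies directly: moving
  a map of degree \<open>p\<close> past the first \<open>r\<close> arguments gives the sign $(-1)^{p(d_1+\cdots+d_r)}$.

  The sum over $r+s+t=n$ is written as a sum over the ways to split the argument list into three
  pieces of lengths $r,s,t$ with \<open>s \<ge> 1\<close>; the sum over compositions $i_1+\cdots+i_r=n$ as a sum
  over the ways to cut the argument list into nonempty blocks.
\<close>

definition insertion_sum ::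
  "('a list \<Rightarrow> 'b::ab_group_add) \<Rightarrow> ('a list \<Rightarrow> 'a) \<Rightarrow> 'd::ring_parity list \<Rightarrow> 'a list \<Rightarrow> 'b" where
  "insertion_sum h b ds xs =
     (\<Sum>(us, vs, ws) \<in> {(us, vs, ws). us @ vs @ ws = xs \<and> vs \<noteq> []}.
        sgn_by (1 * sum_list (take (length us) ds)) (h (us @ b vs # ws)))"

locale a_infinity_algebra = graded_vector_space scale gr
  for scale :: "'k::field \<Rightarrow> 'a::ab_group_add \<Rightarrow> 'a"
    and gr :: "'d::ring_parity \<Rightarrow> 'a set" +
  fixes b :: "'a list \<Rightarrow> 'a"
  assumes multilinear_b: "multilinear scale scale b"
    and degree_b: "has_degree gr gr 1 b"
    and a_infinity_relation:
      "xs \<noteq> [] \<Longrightarrow> homogeneous gr ds xs \<Longrightarrow> insertion_sum b b ds xs = 0"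

definition a_infinity_morphism ::
  "('k::field \<Rightarrow> 'a::ab_group_add \<Rightarrow> 'a) \<Rightarrow> ('d::ring_parity \<Rightarrow> 'a set) \<Rightarrow> ('a list \<Rightarrow> 'a) \<Rightarrow>
   ('k \<Rightarrow> 'b::ab_group_add \<Rightarrow> 'b) \<Rightarrow> ('d \<Rightarrow> 'b set) \<Rightarrow> ('b list \<Rightarrow> 'b) \<Rightarrow>
   ('a list \<Rightarrow> 'b) \<Rightarrow> bool" where
  "a_infinity_morphism sA gA bA sB gB bB f \<longleftrightarrow>
     multilinear sA sB f \<and> has_degree gA gB 0 f \<and>
     (\<forall>ds xs. xs \<noteq> [] \<longrightarrow> homogeneous gA ds xs \<longrightarrow>
        insertion_sum f bA ds xs =
          (\<Sum>yss | concat yss = xs \<and> [] \<notin> set yss. bB (map f yss)))"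

definition a_infinity_homotopy ::
  "('k::field \<Rightarrow> 'a::ab_group_add \<Rightarrow> 'a) \<Rightarrow> ('d::ring_parity \<Rightarrow> 'a set) \<Rightarrow> ('a list \<Rightarrow> 'a) \<Rightarrow>
   ('k \<Rightarrow> 'b::ab_group_add \<Rightarrow> 'b) \<Rightarrow> ('d \<Rightarrow> 'b set) \<Rightarrow> ('b list \<Rightarrow> 'b) \<Rightarrow>
   ('a list \<Rightarrow> 'b) \<Rightarrow> ('a list \<Rightarrow> 'b) \<Rightarrow> ('a list \<Rightarrow> 'b) \<Rightarrow> bool" where
  "a_infinity_homotopy sA gA bA sB gB bB f g \<eta> \<longleftrightarrow>
     multilinear sA sB \<eta> \<and> has_degree gA gB (-1) \<eta> \<and>
     (\<forall>ds xs. xs \<noteq> [] \<longrightarrow> homogeneous gA ds xs \<longrightarrow>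
        g xs - f xs =
          (\<Sum>(uss, vs, wss) \<in> {(uss, vs, wss). concat uss @ vs @ concat wss = xs \<and>
                 vs \<noteq> [] \<and> [] \<notin> set uss \<and> [] \<notin> set wss}.
             sgn_by (- 1 * sum_list (take (length (concat uss)) ds))
               (bB (map g uss @ \<eta> vs # map f wss)))
          + insertion_sum \<eta> bA ds xs)"

section \<open>Cohomology\<close>

definition cohomologous :: "('a::ab_group_add list \<Rightarrow> 'a) \<Rightarrow> ('a \<times> 'a) set" where
  "cohomologous b = {(x, y). b [x] = 0 \<and> b [y] = 0 \<and> (\<exists>z. y - x = b [z])}"

definition cohomology :: "('a::ab_group_add list \<Rightarrow> 'a) \<Rightarrow> 'a set set" where
  "cohomology b = {x. b [x] = 0} // cohomologous b"

text \<open>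
  For \<open>x\<close> not closed the following is the empty set, which is not an element of
  \<^term>\<open>cohomology b\<close>.
\<close>

definition cohomology_class :: "('a::ab_group_add list \<Rightarrow> 'a) \<Rightarrow> 'a \<Rightarrow> 'a set" where
  "cohomology_class b x = cohomologous b `` {x}"

definition pushforward ::
  "('b::ab_group_add list \<Rightarrow> 'b) \<Rightarrow> ('a list \<Rightarrow> 'b) \<Rightarrow> 'a set \<Rightarrow> 'b set" where
  "pushforward bB f \<alpha> = (\<Union>x\<in>\<alpha>. cohomology_class bB (f [x]))"

section \<open>Matrices over tensor powers\<close>

text \<open>
  An element $\sum_k x_{k,1}\otimes\cdots\otimes x_{k,n}$ of $A^{\otimes n}$ is represented by the
  multiset of the words \<open>[x\<^sub>k\<^sub>,\<^sub>1, \<dots>, x\<^sub>k\<^sub>,\<^sub>n]\<close>; addition is multiset union, the tensor product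
  is bilinear extension of concatenation, and a multilinear map is evaluated word by word.  The
  representation is not unique, but its values under multilinear maps are, and only these
  are used below.
\<close>

definition tensor :: "'a list multiset \<Rightarrow> 'a list multiset \<Rightarrow> 'a list multiset" where
  "tensor x y = (\<Sum>u\<in>#x. image_mset (\<lambda>v. u @ v) y)"

definition eval_tensor :: "('a list \<Rightarrow> 'b::comm_monoid_add) \<Rightarrow> 'a list multiset \<Rightarrow> 'b" where
  "eval_tensor h x = (\<Sum>w\<in>#x. h w)"

definition as_tensors :: "'a mat \<Rightarrow> 'a list multiset mat" where
  "as_tensors a = map_mat (\<lambda>x. {#[x]#}) a"

definition odot :: "'a list multiset mat \<Rightarrow> 'a list multiset mat \<Rightarrow> 'a list multiset mat" where
  "odot X Y = mat (dim_row X) (dim_col Y)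
     (\<lambda>(i, j). \<Sum>k<dim_col X. tensor (X $$ (i, k)) (Y $$ (k, j)))"

text \<open>The zeroth power is the identity matrix over $A^{\otimes 0}=\mathbb{K}$.\<close>

fun odot_power :: "'a mat \<Rightarrow> nat \<Rightarrow> 'a list multiset mat" where
  "odot_power a 0 = mat (dim_row a) (dim_row a) (\<lambda>(i, j). if i = j then {#[]#} else {#})"
| "odot_power a (Suc n) = odot (as_tensors a) (odot_power a n)"

definition Mat_plus :: "nat \<Rightarrow> 'a::zero mat set" where
  "Mat_plus m = {a \<in> carrier_mat (m + 1) (m + 1). \<forall>i\<le>m. \<forall>j\<le>i. a $$ (i, j) = 0}"

text \<open>
  With \<open>m + 1\<close> the size of the matrix, the sums over \<open>n \<ge> 1\<close>, respectively \<open>r, t \<ge> 0\<close>, may be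
  restricted to \<open>n \<le> m\<close>, respectively \<open>r + 1 + t \<le> m\<close>: for strictly upper-triangular matrices
  all other summands vanish, see the lemmas \<open>odot_power_vanishes\<close> and \<open>odot_mixed_vanishes\<close>.
\<close>

definition power_sum :: "('a list \<Rightarrow> 'b::ab_group_add) \<Rightarrow> 'a mat \<Rightarrow> 'b mat" where
  "power_sum h a = mat (dim_row a) (dim_col a)
     (\<lambda>ij. \<Sum>n = 1..<dim_row a. map_mat (eval_tensor h) (odot_power a n) $$ ij)"

definition mixed_sum ::
  "('a list \<Rightarrow> 'b::ab_group_add) \<Rightarrow> 'a mat \<Rightarrow> 'a mat \<Rightarrow> 'a mat \<Rightarrow> 'b mat" where
  "mixed_sum h a' c a = mat (dim_row a) (dim_col a)
     (\<lambda>ij. \<Sum>(r, t) \<in> {(r, t). r + 1 + t < dim_row a}.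
        map_mat (eval_tensor h)
          (odot (odot (odot_power a' r) (as_tensors c)) (odot_power a t)) $$ ij)"

definition approx :: "nat \<Rightarrow> 'a mat \<Rightarrow> 'a mat \<Rightarrow> bool" where
  "approx m a a' \<longleftrightarrow> (\<forall>i\<le>m. \<forall>j\<le>m. (i, j) \<noteq> (0, m) \<longrightarrow> a $$ (i, j) = a' $$ (i, j))"

section \<open>Defining systems\<close>

definition defining_system ::
  "nat \<Rightarrow> ('a::ab_group_add list \<Rightarrow> 'a) \<Rightarrow> (nat \<Rightarrow> 'a set) \<Rightarrow> 'a mat \<Rightarrow> bool" where
  "defining_system m b \<alpha> a \<longleftrightarrow>
     a \<in> Mat_plus m \<and> approx m (power_sum b a) (0\<^sub>m (m + 1) (m + 1)) \<and>
     (\<forall>i\<in>{1..m}. \<alpha> i \<in> cohomology b \<and> a $$ (i - 1, i) \<in> \<alpha> i)"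

definition massey_cocycle :: "nat \<Rightarrow> ('a::ab_group_add list \<Rightarrow> 'a) \<Rightarrow> 'a mat \<Rightarrow> 'a" where
  "massey_cocycle m b a = power_sum b a $$ (0, m)"

definition equivalent_defining_systems ::
  "nat \<Rightarrow> ('d::ring_parity \<Rightarrow> 'a::ab_group_add set) \<Rightarrow> ('a list \<Rightarrow> 'a) \<Rightarrow>
   (nat \<Rightarrow> 'a set) \<Rightarrow> 'a mat \<Rightarrow> 'a mat \<Rightarrow> bool" where
  "equivalent_defining_systems m gr b \<alpha> a a' \<longleftrightarrow>
     defining_system m b \<alpha> a \<and> defining_system m b \<alpha> a' \<and>
     (\<exists>c\<in>Mat_plus m. approx m (a' - a) (mixed_sum b (map_mat (bar gr) a') c a))"

section \<open>Finiteness of the sums\<close>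

lemma multilinear_zero: "multilinear sA sB h \<Longrightarrow> 0 \<in> set w \<Longrightarrow> h w = 0"
  unfolding multilinear_def by (metis Vector_Spaces.linear.axioms(3) module_hom.zero split_list)

definition raises :: "nat \<Rightarrow> nat \<Rightarrow> 'a::zero list multiset mat \<Rightarrow> bool" where
  "raises m d X \<longleftrightarrow> X \<in> carrier_mat (m + 1) (m + 1) \<and>
     (\<forall>i\<le>m. \<forall>j\<le>m. \<forall>w. w \<in># X $$ (i, j) \<longrightarrow> 0 \<notin> set w \<longrightarrow> i + d \<le> j)"

lemma raises_as_tensors:
  assumes "a \<in> Mat_plus m" shows "raises m 1 (as_tensors a)"
proof -
  have "i < j" if "i \<le> m" "j \<le> m" "a $$ (i, j) \<noteq> 0" for i j
    using assms that by (auto simp: Mat_plus_def not_less[symmetric])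
  then show ?thesis
    using assms by (auto simp: Mat_plus_def raises_def as_tensors_def Suc_le_eq)
qed

lemma raises_odot:
  assumes X: "raises m d X" and Y: "raises m e Y"
  shows "raises m (d + e) (odot X Y)"
proof -
  have dims: "dim_row X = m + 1" "dim_col X = m + 1" "dim_row Y = m + 1" "dim_col Y = m + 1"
    using X Y by (auto simp: raises_def)
  have "i + (d + e) \<le> j"
    if ij: "i \<le> m" "j \<le> m" and w: "w \<in># odot X Y $$ (i, j)" "0 \<notin> set w" for i j w
  proof -
    have "odot X Y $$ (i, j) = (\<Sum>k<m + 1. tensor (X $$ (i, k)) (Y $$ (k, j)))"
      using ij by (simp add: odot_def dims)
    with w obtain k where k: "k < m + 1" "w \<in># tensor (X $$ (i, k)) (Y $$ (k, j))"
      by (auto simp: set_mset_sum simp del: sum.lessThan_Suc)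
    then obtain u v where "u \<in># X $$ (i, k)" "v \<in># Y $$ (k, j)" "w = u @ v"
      by (auto simp: tensor_def)
    then have "i + d \<le> k" "k + e \<le> j"
      using X Y k ij w by (auto simp: raises_def)
    then show ?thesis by simp
  qed
  then show ?thesis by (auto simp: raises_def odot_def dims)
qed

lemma raises_odot_power: "a \<in> Mat_plus m \<Longrightarrow> raises m n (odot_power a n)"
proof (induction n)
  case 0
  then show ?case by (auto simp: raises_def Mat_plus_def split: if_splits)
next
  case (Suc n)
  then show ?case using raises_odot[OF raises_as_tensors, of a m n] by simp
qed

lemma raises_vanishes:
  assumes "multilinear sA sB h" "raises m d X" "m < d"
  shows "map_mat (eval_tensor h) X = 0\<^sub>m (m + 1) (m + 1)"
proof (rule eq_matI)
  fix i j assume "i < dim_row (0\<^sub>m (m + 1) (m + 1))" "j < dim_col (0\<^sub>m (m + 1) (m + 1))"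
  then have ij: "i \<le> m" "j \<le> m" by auto
  have "h w = 0" if "w \<in># X $$ (i, j)" for w
    using assms ij that multilinear_zero[OF assms(1)] by (force simp: raises_def)
  then have "eval_tensor h (X $$ (i, j)) = 0"
    unfolding eval_tensor_def by (simp cong: image_mset_cong)
  then show "map_mat (eval_tensor h) X $$ (i, j) = 0\<^sub>m (m + 1) (m + 1) $$ (i, j)"
    using assms(2) ij by (auto simp: raises_def)
qed (use assms in \<open>auto simp: raises_def\<close>)

lemma odot_power_vanishes:
  assumes "multilinear sA sB h" "a \<in> Mat_plus m" "n > m"
  shows "map_mat (eval_tensor h) (odot_power a n) = 0\<^sub>m (m + 1) (m + 1)"
  using raises_vanishes[OF assms(1) raises_odot_power[OF assms(2)] assms(3)] .

lemma odot_mixed_vanishes: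
  assumes "multilinear sA sB h" "a \<in> Mat_plus m" "a' \<in> Mat_plus m" "c \<in> Mat_plus m"
    and "r + 1 + t > m"
  shows "map_mat (eval_tensor h)
           (odot (odot (odot_power a' r) (as_tensors c)) (odot_power a t)) = 0\<^sub>m (m + 1) (m + 1)"
  using raises_vanishes[OF assms(1) raises_odot[OF raises_odot[OF raises_odot_power[OF assms(3)]
        raises_as_tensors[OF assms(4)]] raises_odot_power[OF assms(2)]] assms(5)] .

end

theory Submission
  imports Defs
begin

text \<open>
  Write \<open>\<partial>a\<close>, \<open>F\<close>, \<open>G\<close>, \<open>H\<close> for the matrices obtained from \<open>a\<close> by \<open>bA\<close>, \<open>f\<close>, \<open>g\<close>, \<open>\<eta>\<close>, that is
  \<^term>\<open>power_sum\<close> of each of these families, and \<open>\<mu> = (\<partial>a)\<^sub>0\<^sub>m\<close>.  For a strictly upper-triangular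
  matrix the entry \<open>(i, j)\<close> of such a matrix is a sum over increasing paths
  \<open>i = k\<^sub>0 < k\<^sub>1 < \<dots> < k\<^sub>n = j\<close>, the summand being the multilinear family applied to the word
  of the entries of \<open>a\<close> along the path.  Each structure relation (of an algebra, a morphism, a
  homotopy) is an identity between sums over ways to cut a word into pieces, and cutting a path
  means choosing intermediate vertices.  Summing a relation over all paths therefore turns it into an
  identity between matrices:
  \<^item> the relation of \<open>f\<close> says that \<open>\<partial>F\<close> is the sum of \<open>f\<close> over paths in which one factor is taken
    from \<open>\<partial>a\<close>, the factors before it from \<open>a\<close> barred, those after it from \<open>a\<close>;
  \<^item> the relation of \<open>\<eta>\<close> says that \<open>G - F\<close> is the sum of \<open>bB\<close> over paths with one factor from
    \<open>H\<close>, those before it from \<open>G\<close> barred and those after it from \<open>F\<close>, plus the sum of \<open>\<eta>\<close> over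
    paths with one factor from \<open>\<partial>a\<close>.

  Since \<open>a\<close> is a defining system, \<open>\<partial>a\<close> vanishes outside its corner \<open>(0, m)\<close>, and a path using the
  step from \<open>0\<close> to \<open>m\<close> has no other step.  So sums with a factor from \<open>\<partial>a\<close> vanish outside the
  corner and have the value \<open>h [\<mu>]\<close> there (\<open>path_sum_insertion\<close>).  Hence \<open>F\<close> and \<open>G\<close> are
  defining systems, with Massey cocycles \<open>f [\<mu>]\<close> and \<open>g [\<mu>]\<close> (\<open>power_sum_morphism\<close>), and \<open>H\<close>
  witnesses their equivalence (\<open>power_sum_homotopy\<close>).  Finally \<open>\<mu>\<close> is closed, by the relation of
  \<open>bA\<close> in the corner, so the homotopy relation for words of length one gives
  \<open>g [\<mu>] - f [\<mu>] = bB [\<eta> [\<mu>]]\<close>, which is the equality of the Massey products.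

  The structure relations speak of homogeneous elements, the matrix entries are arbitrary.  Once the
  Koszul signs are written by means of \<^const>\<open>bar\<close>, both sides of each relation are additive in every
  slot, so the relations extend to all words (\<open>slot_additive_eq_0\<close>).
\<close>

section \<open>Sums over splittings of a word\<close>

text \<open>
  This is what allows sums over paths, and sums of homogeneous components, to be pulled out of a slot.
  It passes to the sums over splittings below, to maps composed with \<^const>\<open>bar\<close>, and to the maps
  obtained by fixing some of the arguments.
\<close>

definition slot_additive :: "('a::ab_group_add list \<Rightarrow> 'b::ab_group_add) \<Rightarrow> bool" where
  "slot_additive h \<longleftrightarrow> (\<forall>us ws. Modules.additive (\<lambda>x. h (us @ x # ws)))"

lemma slot_additiveD: "slot_additive h \<Longrightarrow> Modules.additive (\<lambda>x. h (us @ x # ws))"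
  by (simp add: slot_additive_def)

lemma slot_additive_add:
  "slot_additive h \<Longrightarrow> h (us @ (x + y) # ws) = h (us @ x # ws) + h (us @ y # ws)"
  using slot_additiveD[of h us ws] by (rule Modules.additive.add)

lemma slot_additive_zero: "slot_additive h \<Longrightarrow> 0 \<in> set w \<Longrightarrow> h w = 0"
  by (auto dest!: split_list simp: Modules.additive.zero[OF slot_additiveD])

lemma slot_additive_append: "slot_additive h \<Longrightarrow> slot_additive (\<lambda>ws. h (us @ ws))"
  by (simp add: slot_additive_def flip: append_assoc)

lemma slot_additive_Cons: "slot_additive h \<Longrightarrow> slot_additive (\<lambda>ws. h (x # ws))"
  using slot_additive_append[of h "[x]"] by simp

lemma slot_additive_before: "slot_additive h \<Longrightarrow> slot_additive (\<lambda>us. h (us @ ws))"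
  unfolding slot_additive_def by simp

lemma slot_additive_plus:
  "slot_additive h \<Longrightarrow> slot_additive h' \<Longrightarrow> slot_additive (\<lambda>w. h w + h' w)"
  unfolding slot_additive_def Modules.additive_def by (simp add: algebra_simps)

lemma slot_additive_diff:
  "slot_additive h \<Longrightarrow> slot_additive h' \<Longrightarrow> slot_additive (\<lambda>w. h w - h' w)"
  unfolding slot_additive_def Modules.additive_def by (simp add: algebra_simps)

lemma slot_additive_sum:
  "(\<And>k. k \<in> K \<Longrightarrow> slot_additive (h k)) \<Longrightarrow> slot_additive (\<lambda>w. \<Sum>k\<in>K. h k w)"
  unfolding slot_additive_def Modules.additive_def by (simp add: sum.distrib)

lemma multilinear_slot_additive:
  assumes "multilinear sA sB h" shows "slot_additive h"
  unfolding slot_additive_def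
proof (intro allI)
  fix us ws
  have "Vector_Spaces.linear sA sB (\<lambda>x. h (us @ x # ws))"
    using assms by (simp add: multilinear_def)
  then show "Modules.additive (\<lambda>x. h (us @ x # ws))"
    by (intro Modules.additive.intro) (simp add: Vector_Spaces.linear_iff)
qed

definition split_sum :: "('a list \<Rightarrow> 'a list \<Rightarrow> 'b::comm_monoid_add) \<Rightarrow> 'a list \<Rightarrow> 'b" where
  "split_sum \<phi> xs = (\<Sum>(us, vs) \<in> {(us, vs). us @ vs = xs}. \<phi> us vs)"

text \<open>
  Splitting the head off gives a recursion on the word; most properties of the sums over splittings
  follow from it by induction.
\<close>

lemma splits_Cons:
  "{(us, vs). us @ vs = x # xs} =
     insert ([], x # xs) ((\<lambda>(us, vs). (x # us, vs)) ` {(us, vs). us @ vs = xs})"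
  by (auto simp: append_eq_Cons_conv image_iff)

lemma finite_splits: "finite {(us, vs). us @ vs = xs}"
proof (induction xs)
  case Nil
  have "{(us, vs). us @ vs = []} = {([], [])}" by auto
  then show ?case by simp
qed (simp add: splits_Cons)

lemma split_sum_Nil [simp]: "split_sum \<phi> [] = \<phi> [] []"
proof -
  have "{(us, vs). us @ vs = []} = {([], [])}" by auto
  then show ?thesis by (simp add: split_sum_def)
qed

lemma split_sum_Cons [simp]:
  "split_sum \<phi> (x # xs) = \<phi> [] (x # xs) + split_sum (\<lambda>us. \<phi> (x # us)) xs"
  unfolding split_sum_def splits_Cons
  by (subst sum.insert)
     (auto simp: sum.reindex inj_on_def case_prod_beta' intro!: finite_imageI finite_splits[unfolded case_prod_beta'])

lemma split_sum_cong:
  "(\<And>us vs. us @ vs = xs \<Longrightarrow> \<phi> us vs = \<psi> us vs) \<Longrightarrow> split_sum \<phi> xs = split_sum \<psi> xs"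
  unfolding split_sum_def by (intro sum.cong) auto

lemma split_sum_distrib:
  "split_sum (\<lambda>us vs. \<phi> us vs + \<psi> us vs) xs = split_sum \<phi> xs + split_sum \<psi> xs"
  unfolding split_sum_def by (simp add: sum.distrib case_prod_unfold)

text \<open>
  A varied entry lies either in the left or in the right piece.  The hypotheses only concern the
  pieces that occur, since in the induction for \<open>cut_sum\<close> the second one is available for proper
  suffixes of the word only.
\<close>

lemma split_sum_add:
  assumes "\<And>v w. v @ w = ws \<Longrightarrow> \<phi> (us @ (x + y) # v) w = \<phi> (us @ x # v) w + \<phi> (us @ y # v) w"
    and "\<And>u v. u @ v = us \<Longrightarrow> \<phi> u (v @ (x + y) # ws) = \<phi> u (v @ x # ws) + \<phi> u (v @ y # ws)"
  shows "split_sum \<phi> (us @ (x + y) # ws) = split_sum \<phi> (us @ x # ws) + split_sum \<phi> (us @ y # ws)"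
  using assms
proof (induction us arbitrary: \<phi>)
  case Nil
  have "split_sum (\<lambda>us. \<phi> ((x + y) # us)) ws =
      split_sum (\<lambda>us vs. \<phi> (x # us) vs + \<phi> (y # us) vs) ws"
    using Nil(1) by (intro split_sum_cong) simp
  then show ?case
    using Nil(2)[of "[]" "[]"] by (simp add: split_sum_distrib algebra_simps)
next
  case (Cons z us)
  have "split_sum (\<lambda>u. \<phi> (z # u)) (us @ (x + y) # ws) =
      split_sum (\<lambda>u. \<phi> (z # u)) (us @ x # ws) + split_sum (\<lambda>u. \<phi> (z # u)) (us @ y # ws)"
    by (rule Cons.IH) (use Cons.prems(1) Cons.prems(2)[of "z # u" for u] in simp_all)
  then show ?case
    using Cons.prems(2)[of "[]" "z # us"] by (simp add: algebra_simps)
qed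

text \<open>
  The common form of the sums $\sum h\circ(1^{\otimes r}\otimes b_s\otimes1^{\otimes t})$ and
  of the sums in the homotopy relation: a nonempty infix is replaced by its value under \<open>p\<close>.
\<close>

definition infix_sum ::
  "('a list \<Rightarrow> 'c) \<Rightarrow> ('a list \<Rightarrow> 'c \<Rightarrow> 'a list \<Rightarrow> 'b::comm_monoid_add) \<Rightarrow> 'a list \<Rightarrow> 'b" where
  "infix_sum p \<Phi> xs =
     (\<Sum>(us, vs, ws) \<in> {(us, vs, ws). us @ vs @ ws = xs \<and> vs \<noteq> []}. \<Phi> us (p vs) ws)"

lemma finite_triple_splits: "finite {(us, vs, ws). us @ vs @ ws = xs}"
proof -
  let ?S = "\<lambda>xs. {(us, vs). us @ vs = xs}"
  have "{(us, vs, ws). us @ vs @ ws = xs} =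
      (\<lambda>(q, q'). (fst q, fst q', snd q')) ` (SIGMA q:?S xs. ?S (snd q))"
    by (force simp: image_iff)
  moreover have "finite (SIGMA q:?S xs. ?S (snd q))"
    by (intro finite_SigmaI finite_splits)
  ultimately show ?thesis by simp
qed

lemma infix_sum_split_sum:
  "infix_sum p \<Phi> xs =
     split_sum (\<lambda>us. split_sum (\<lambda>vs ws. if vs = [] then 0 else \<Phi> us (p vs) ws)) xs"
proof -
  let ?S = "\<lambda>xs. {(us, vs). us @ vs = xs}"
  let ?\<Psi> = "\<lambda>us vs ws. if vs = [] then 0 else \<Phi> us (p vs) ws"
  have "split_sum (\<lambda>us. split_sum (?\<Psi> us)) xs =
      (\<Sum>q\<in>?S xs. \<Sum>q'\<in>?S (snd q). ?\<Psi> (fst q) (fst q') (snd q'))"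
    by (simp add: split_sum_def case_prod_unfold)
  also have "\<dots> = (\<Sum>(q, q') \<in> (SIGMA q:?S xs. ?S (snd q)). ?\<Psi> (fst q) (fst q') (snd q'))"
    by (rule sum.Sigma) (auto simp: finite_splits)
  also have "\<dots> = (\<Sum>(us, vs, ws) \<in> {(us, vs, ws). us @ vs @ ws = xs}. ?\<Psi> us vs ws)"
    by (rule sum.reindex_bij_witness
        [where i = "\<lambda>(us, vs, ws). ((us, vs @ ws), (vs, ws))"
           and j = "\<lambda>(q, q'). (fst q, fst q', snd q')"]) auto
  also have "\<dots> = infix_sum p \<Phi> xs"
    unfolding infix_sum_def
  proof (rule sum.mono_neutral_cong_right)
    show "finite {(us, vs, ws). us @ vs @ ws = xs}" by (rule finite_triple_splits)
  qed auto
  finally show ?thesis by simp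
qed

lemma infix_sum_single [simp]: "infix_sum p \<Phi> [x] = \<Phi> [] (p [x]) []"
  by (simp add: infix_sum_split_sum)

lemma slot_additive_infix_sum:
  assumes p: "slot_additive p"
    and left: "\<And>z ws. slot_additive (\<lambda>us. \<Phi> us z ws)"
    and mid: "\<And>us ws. Modules.additive (\<lambda>z. \<Phi> us z ws)"
    and right: "\<And>us z. slot_additive (\<Phi> us z)"
  shows "slot_additive (infix_sum p \<Phi>)"
  unfolding slot_additive_def infix_sum_split_sum
proof (intro allI Modules.additive.intro split_sum_add)
  fix us ws v w x y
  show "split_sum (\<lambda>vs ws. if vs = [] then 0 else \<Phi> (us @ (x + y) # v) (p vs) ws) w =
      split_sum (\<lambda>vs ws. if vs = [] then 0 else \<Phi> (us @ x # v) (p vs) ws) w +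
      split_sum (\<lambda>vs ws. if vs = [] then 0 else \<Phi> (us @ y # v) (p vs) ws) w"
    unfolding split_sum_distrib[symmetric]
    by (intro split_sum_cong) (simp add: slot_additive_add[OF left])
qed (auto simp: slot_additive_add[OF p] slot_additive_add[OF right] Modules.additive.add[OF mid])

text \<open>
  This is $\sum\phi_r\circ(f_{i_1}\otimes\cdots\otimes f_{i_r})$.  The empty word has exactly one cut,
  into no blocks.
\<close>

definition cut_sum ::
  "('c list \<Rightarrow> 'b::comm_monoid_add) \<Rightarrow> ('a list \<Rightarrow> 'c) \<Rightarrow> 'a list \<Rightarrow> 'b" where
  "cut_sum \<phi> f xs = (\<Sum>yss | concat yss = xs \<and> [] \<notin> set yss. \<phi> (map f yss))"

lemma cuts_Nil: "{yss. concat yss = [] \<and> [] \<notin> set yss} = {[]}"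
proof -
  have "yss = []" if "concat yss = []" "[] \<notin> set yss" for yss :: "'a list list"
    using that by (cases yss) auto
  then show ?thesis by auto
qed

lemma cuts_nonempty:
  assumes "xs \<noteq> []"
  shows "{yss. concat yss = xs \<and> [] \<notin> set yss} =
    (\<lambda>((us, vs), zss). us # zss) `
      (SIGMA q : {(us, vs). us @ vs = xs \<and> us \<noteq> []}. {zss. concat zss = snd q \<and> [] \<notin> set zss})"
    (is "?L = ?R")
proof
  show "?L \<subseteq> ?R"
  proof
    fix yss assume "yss \<in> ?L"
    then show "yss \<in> ?R" using assms by (cases yss) (force simp: image_iff)+
  qed
qed auto

lemma finite_cuts: "finite {yss. concat yss = xs \<and> [] \<notin> set yss}"
proof (induction xs rule: length_induct)
  case (1 xs)
  show ?case
  proof (cases "xs = []")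
    case False
    have "finite {(us, vs). us @ vs = xs \<and> us \<noteq> []}"
      by (rule finite_subset[OF _ finite_splits[of xs]]) auto
    moreover have "finite {zss. concat zss = snd q \<and> [] \<notin> set zss}"
      if "q \<in> {(us, vs). us @ vs = xs \<and> us \<noteq> []}" for q
      using that 1 by (cases q) auto
    ultimately show ?thesis
      unfolding cuts_nonempty[OF False] by (intro finite_imageI finite_SigmaI)
  next
    case True
    show ?thesis unfolding True cuts_Nil by simp
  qed
qed

lemma cut_sum_Nil [simp]: "cut_sum \<phi> f [] = \<phi> []"
  unfolding cut_sum_def cuts_Nil by simp

text \<open>
  Choosing the first block reduces sums over cuts to sums over splittings.
\<close>

lemma cut_sum_nonempty:
  assumes "xs \<noteq> []"
  shows "cut_sum \<phi> f xs =
    split_sum (\<lambda>us vs. if us = [] then 0 else cut_sum (\<lambda>l. \<phi> (f us # l)) f vs) xs"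
proof -
  let ?S = "{(us, vs). us @ vs = xs \<and> us \<noteq> []}"
  have fin: "finite ?S"
    by (rule finite_subset[OF _ finite_splits[of xs]]) auto
  have "cut_sum \<phi> f xs =
     (\<Sum>(q, zss) \<in> (SIGMA q : ?S. {zss. concat zss = snd q \<and> [] \<notin> set zss}).
        \<phi> (f (fst q) # map f zss))"
    unfolding cut_sum_def cuts_nonempty[OF assms]
    by (subst sum.reindex) (auto simp: inj_on_def case_prod_unfold)
  also have "\<dots> = (\<Sum>(us, vs) \<in> ?S. cut_sum (\<lambda>l. \<phi> (f us # l)) f vs)"
    unfolding cut_sum_def case_prod_unfold
    by (subst sum.Sigma) (use fin finite_cuts in \<open>auto simp: case_prod_unfold\<close>)
  also have "\<dots> = split_sum (\<lambda>us vs. if us = [] then 0 else cut_sum (\<lambda>l. \<phi> (f us # l)) f vs) xs"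
    unfolding split_sum_def
    by (rule sum.mono_neutral_cong_left) (auto simp: finite_splits)
  finally show ?thesis .
qed

lemma cut_sum_single [simp]: "cut_sum \<phi> f [x] = \<phi> [f [x]]"
  by (simp add: cut_sum_nonempty)

lemma cut_sum_distrib:
  "cut_sum (\<lambda>l. \<phi> l + \<psi> l) f xs = cut_sum \<phi> f xs + cut_sum \<psi> f xs"
  by (simp add: cut_sum_def sum.distrib)

lemma slot_additive_cut_sum:
  assumes "slot_additive \<phi>" and f: "slot_additive f"
  shows "slot_additive (cut_sum \<phi> f)"
  unfolding slot_additive_def
proof (intro allI Modules.additive.intro)
  fix us ws x y
  from assms(1)
  show "cut_sum \<phi> f (us @ (x + y) # ws) = cut_sum \<phi> f (us @ x # ws) + cut_sum \<phi> f (us @ y # ws)"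
  proof (induction us arbitrary: \<phi> rule: length_induct)
    case (1 us \<phi>)
    let ?\<Psi> = "\<lambda>us vs. if us = [] then 0 else cut_sum (\<lambda>l. \<phi> (f us # l)) f vs"
    have "split_sum ?\<Psi> (us @ (x + y) # ws) =
        split_sum ?\<Psi> (us @ x # ws) + split_sum ?\<Psi> (us @ y # ws)"
    proof (rule split_sum_add)
      fix v w
      show "?\<Psi> (us @ (x + y) # v) w = ?\<Psi> (us @ x # v) w + ?\<Psi> (us @ y # v) w"
        using slot_additive_add[OF 1(2), of "[]"]
        by (simp add: slot_additive_add[OF f] cut_sum_distrib)
    next
      fix u v assume "u @ v = us"
      then show "?\<Psi> u (v @ (x + y) # ws) = ?\<Psi> u (v @ x # ws) + ?\<Psi> u (v @ y # ws)"
        using 1(1) slot_additive_Cons[OF 1(2)] by (cases "u = []") auto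
    qed
    then show ?case by (simp add: cut_sum_nonempty)
  qed
qed

section \<open>Sums over increasing paths\<close>

text \<open>
  The sum of \<open>\<phi> [a\<^sub>i\<^sub>k, a\<^sub>k\<^sub>l, \<dots>]\<close> over all increasing paths from \<open>i\<close> to \<open>j\<close>; for \<open>i = j\<close> there is only
  the trivial path, with the empty word.  Recursion on the first step keeps every sum finite and
  avoids an explicit set of paths.  The functional \<open>\<phi>\<close> is an argument so that path sums may be
  nested.
\<close>

function path_sum :: "'a mat \<Rightarrow> nat \<Rightarrow> nat \<Rightarrow> ('a list \<Rightarrow> 'b::comm_monoid_add) \<Rightarrow> 'b" where
  "path_sum a i j \<phi> =
     (if i = j then \<phi> [] else 0) + (\<Sum>k\<in>{i<..j}. path_sum a k j (\<lambda>w. \<phi> (a $$ (i, k) # w)))"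
  by auto
termination by (relation "measure (\<lambda>(a, i, j, \<phi>). j - i)") auto

declare path_sum.simps [simp del]

lemma path_sum_same [simp]: "path_sum a i i \<phi> = \<phi> []"
  by (subst path_sum.simps) simp

lemma path_sum_above: "j < i \<Longrightarrow> path_sum a i j \<phi> = 0"
  by (subst path_sum.simps) simp

lemma path_sum_less:
  "i < j \<Longrightarrow> path_sum a i j \<phi> = (\<Sum>k\<in>{i<..j}. path_sum a k j (\<lambda>w. \<phi> (a $$ (i, k) # w)))"
  by (subst path_sum.simps) simp

lemma path_sum_cong:
  assumes "i < j" "\<And>w. w \<noteq> [] \<Longrightarrow> \<phi> w = \<psi> w"
  shows "path_sum a i j \<phi> = path_sum a i j \<psi>"
  using assms by (simp add: path_sum_less)

lemma path_sum_distrib: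
  "path_sum a i j (\<lambda>w. \<phi> w + \<psi> w) = path_sum a i j \<phi> + path_sum a i j \<psi>"
proof (induction "j - i" arbitrary: i \<phi> \<psi> rule: less_induct)
  case less
  have "path_sum a k j (\<lambda>w. \<phi> (a $$ (i, k) # w) + \<psi> (a $$ (i, k) # w)) =
      path_sum a k j (\<lambda>w. \<phi> (a $$ (i, k) # w)) + path_sum a k j (\<lambda>w. \<psi> (a $$ (i, k) # w))"
    if "k \<in> {i<..j}" for k
    using that by (intro less) auto
  then show ?case
    by (subst (1 2 3) path_sum.simps) (simp add: sum.distrib algebra_simps)
qed

lemma path_sum_zero [simp]: "path_sum a i j (\<lambda>w. 0) = (0 :: 'b::comm_monoid_add)"
proof (induction "j - i" arbitrary: i rule: less_induct)
  case less
  have "path_sum a k j (\<lambda>w. 0) = (0 :: 'b)" if "k \<in> {i<..j}" for k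
    using that by (intro less) auto
  then show ?case by (subst path_sum.simps) simp
qed

lemma path_sum_sum: "path_sum a i j (\<lambda>w. \<Sum>k\<in>K. \<phi> k w) = (\<Sum>k\<in>K. path_sum a i j (\<phi> k))"
  by (induction K rule: infinite_finite_induct) (simp_all add: path_sum_distrib)

lemma path_sum_additive:
  assumes "Modules.additive D"
  shows "path_sum a i j (\<lambda>w. D (\<phi> w)) = D (path_sum a i j \<phi>)"
proof (induction "j - i" arbitrary: i \<phi> rule: less_induct)
  case less
  have "path_sum a k j (\<lambda>w. D (\<phi> (a $$ (i, k) # w))) =
      D (path_sum a k j (\<lambda>w. \<phi> (a $$ (i, k) # w)))"
    if "k \<in> {i<..j}" for k
    using that by (intro less) auto
  then show ?case
    by (subst (1 2) path_sum.simps)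
       (simp add: Modules.additive.add[OF assms] Modules.additive.sum[OF assms]
          Modules.additive.zero[OF assms])
qed

text \<open>
  Splitting the word of a path amounts to choosing the vertex at which the path is broken.
\<close>

lemma path_sum_split_sum:
  "path_sum a i j (split_sum \<phi>) = (\<Sum>k\<in>{i..j}. path_sum a i k (\<lambda>us. path_sum a k j (\<phi> us)))"
proof (induction "j - i" arbitrary: i \<phi> rule: less_induct)
  case less
  show ?case
  proof (cases "i \<le> j")
    case False
    then show ?thesis by (simp add: path_sum_above)
  next
    case True
    let ?T = "\<lambda>k l. path_sum a k l (\<lambda>us. path_sum a l j (\<phi> (a $$ (i, k) # us)))"
    have "path_sum a i j (split_sum \<phi>) = (if i = j then \<phi> [] [] else 0) +
        (\<Sum>k\<in>{i<..j}. path_sum a k j (\<lambda>w. \<phi> [] (a $$ (i, k) # w)) +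
           path_sum a k j (split_sum (\<lambda>us. \<phi> (a $$ (i, k) # us))))"
      by (subst path_sum.simps) (simp add: path_sum_distrib)
    also have "\<dots> = path_sum a i j (\<phi> []) +
        (\<Sum>k\<in>{i<..j}. path_sum a k j (split_sum (\<lambda>us. \<phi> (a $$ (i, k) # us))))"
      by (subst (3) path_sum.simps) (simp add: sum.distrib add.assoc)
    also have "(\<Sum>k\<in>{i<..j}. path_sum a k j (split_sum (\<lambda>us. \<phi> (a $$ (i, k) # us)))) =
        (\<Sum>k\<in>{i<..j}. \<Sum>l\<in>{k..j}. ?T k l)"
      by (rule sum.cong[OF refl]) (rule less, auto)
    also have "\<dots> = (\<Sum>k\<in>{i<..j}. \<Sum>l\<in>{l\<in>{i..j}. k \<le> l}. ?T k l)"
      by (intro sum.cong) auto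
    also have "\<dots> = (\<Sum>l\<in>{i..j}. \<Sum>k\<in>{k\<in>{i<..j}. k \<le> l}. ?T k l)"
      by (rule sum.swap_restrict) auto
    also have "\<dots> = (\<Sum>l\<in>{i..j}. \<Sum>k\<in>{i<..l}. ?T k l)"
      by (intro sum.cong) auto
    also have "path_sum a i j (\<phi> []) = (\<Sum>l\<in>{i..j}. if i = l then path_sum a l j (\<phi> []) else 0)"
      using True by simp
    finally show ?thesis
      by (subst (2) path_sum.simps) (simp add: sum.distrib)
  qed
qed

text \<open>
  Replacing an infix of the word by its value under \<open>p\<close>, summed over all paths, means replacing one
  step \<open>(k, l)\<close> by the path sum of \<open>p\<close>, since the sum over the subpaths from \<open>k\<close> to \<open>l\<close> may be taken
  inside the additive map \<open>\<Phi>\<close>.  Nonempty infixes correspond to \<open>k < l\<close>.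
\<close>

lemma path_sum_infix_sum:
  assumes "\<And>us ws. Modules.additive (\<lambda>z. \<Phi> us z ws)"
  shows "path_sum a i j (infix_sum p \<Phi>) =
    (\<Sum>k\<in>{i..j}. \<Sum>l\<in>{k<..j}.
       path_sum a i k (\<lambda>us. path_sum a l j (\<Phi> us (path_sum a k l p))))"
proof -
  let ?\<Psi> = "\<lambda>us vs ws. if vs = [] then 0 else \<Phi> us (p vs) ws"
  have D: "Modules.additive (\<lambda>z. path_sum a l j (\<Phi> us z))" for l us
  proof
    fix x y
    have "\<Phi> us (x + y) = (\<lambda>ws. \<Phi> us x ws + \<Phi> us y ws)"
      using Modules.additive.add[OF assms] by (intro ext)
    then show "path_sum a l j (\<Phi> us (x + y)) = path_sum a l j (\<Phi> us x) + path_sum a l j (\<Phi> us y)"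
      by (simp add: path_sum_distrib)
  qed
  have *: "path_sum a k l (\<lambda>vs. path_sum a l j (?\<Psi> us vs)) =
      (if k = l then 0 else path_sum a l j (\<Phi> us (path_sum a k l p)))" if "k \<le> l" for k l us
  proof (cases "k = l")
    case False
    then have "path_sum a k l (\<lambda>vs. path_sum a l j (?\<Psi> us vs)) =
        path_sum a k l (\<lambda>vs. path_sum a l j (\<Phi> us (p vs)))"
      using that by (intro path_sum_cong[where i = k]) auto
    then show ?thesis using False path_sum_additive[OF D] by simp
  qed simp
  have "path_sum a i j (infix_sum p \<Phi>) =
      (\<Sum>k\<in>{i..j}. path_sum a i k (\<lambda>us. path_sum a k j (split_sum (?\<Psi> us))))"
    unfolding infix_sum_split_sum[abs_def] path_sum_split_sum ..
  also have "\<dots> = (\<Sum>k\<in>{i..j}. path_sum a i k (\<lambda>us. \<Sum>l\<in>{k..j}.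
      if k = l then 0 else path_sum a l j (\<Phi> us (path_sum a k l p))))"
    unfolding path_sum_split_sum using * by simp
  also have "\<dots> = (\<Sum>k\<in>{i..j}. path_sum a i k (\<lambda>us. \<Sum>l\<in>{k<..j}.
      path_sum a l j (\<Phi> us (path_sum a k l p))))"
    by (intro sum.cong refl arg_cong[where f = "path_sum a i _"] ext sum.mono_neutral_cong_right) auto
  finally show ?thesis by (simp add: path_sum_sum)
qed

text \<open>
  A path of \<open>a\<close> with its word cut into blocks is a path through the block boundaries, each step
  \<open>(k, l)\<close> of which is refined to a path from \<open>k\<close> to \<open>l\<close>.  Summing over the refinements replaces the
  matrix \<open>a\<close> by the matrix \<open>F\<close> of the path sums of \<open>f\<close>.
\<close>

lemma path_sum_cut_sum:
  assumes "slot_additive \<phi>"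
    and F: "\<And>k l. k < l \<Longrightarrow> l \<le> j \<Longrightarrow> F $$ (k, l) = path_sum a k l f"
  shows "path_sum a i j (cut_sum \<phi> f) = path_sum F i j \<phi>"
  using assms(1)
proof (induction "j - i" arbitrary: i \<phi> rule: less_induct)
  case less
  consider "i = j" | "j < i" | "i < j" by linarith
  then show ?case
  proof cases
    case 3
    let ?\<Psi> = "\<lambda>us vs. if us = [] then 0 else cut_sum (\<lambda>l. \<phi> (f us # l)) f vs"
    have D: "Modules.additive (\<lambda>z. path_sum F k j (\<lambda>w. \<phi> (z # w)))" for k
      using slot_additive_add[OF less(2), of "[]"]
      by (intro Modules.additive.intro) (simp add: path_sum_distrib)
    have *: "path_sum a i k (\<lambda>us. path_sum a k j (?\<Psi> us)) =
        path_sum F k j (\<lambda>w. \<phi> (F $$ (i, k) # w))" if k: "k \<in> {i<..j}" for k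
    proof -
      have "path_sum a i k (\<lambda>us. path_sum a k j (?\<Psi> us)) =
          path_sum a i k (\<lambda>us. path_sum F k j (\<lambda>w. \<phi> (f us # w)))"
        using k less slot_additive_Cons[OF less(2)] by (intro path_sum_cong) auto
      then show ?thesis using k F path_sum_additive[OF D] by simp
    qed
    have "path_sum a i j (cut_sum \<phi> f) = path_sum a i j (split_sum ?\<Psi>)"
      using 3 by (intro path_sum_cong) (simp_all add: cut_sum_nonempty)
    also have "\<dots> = (\<Sum>k\<in>{i..j}. path_sum a i k (\<lambda>us. path_sum a k j (?\<Psi> us)))"
      by (rule path_sum_split_sum)
    also have "\<dots> = (\<Sum>k\<in>{i<..j}. path_sum F k j (\<lambda>w. \<phi> (F $$ (i, k) # w)))"
      using * by (intro sum.mono_neutral_cong_right) auto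
    finally show ?thesis using 3 by (simp add: path_sum_less)
  qed (simp_all add: path_sum_above)
qed

section \<open>Matrix sums as path sums\<close>

lemma eval_tensor_sum: "eval_tensor \<phi> (\<Sum>k\<in>K. X k) = (\<Sum>k\<in>K. eval_tensor \<phi> (X k))"
  by (induction K rule: infinite_finite_induct) (simp_all add: eval_tensor_def)

lemma eval_tensor_tensor:
  "eval_tensor \<phi> (tensor x y) = eval_tensor (\<lambda>u. eval_tensor (\<lambda>v. \<phi> (u @ v)) y) x"
  by (induction x) (simp_all add: tensor_def eval_tensor_def image_mset.compositionality o_def)

lemma sum_eval_tensor:
  "(\<Sum>k\<in>K. eval_tensor (\<phi> k) x) = eval_tensor (\<lambda>w. \<Sum>k\<in>K. \<phi> k w) x"
  by (induction x) (simp_all add: eval_tensor_def sum.distrib)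

lemma eval_tensor_odot:
  assumes "X \<in> carrier_mat (m + 1) (m + 1)" "Y \<in> carrier_mat (m + 1) (m + 1)" "i \<le> m" "j \<le> m"
  shows "eval_tensor \<phi> (odot X Y $$ (i, j)) =
    (\<Sum>k\<le>m. eval_tensor (\<lambda>u. eval_tensor (\<lambda>v. \<phi> (u @ v)) (Y $$ (k, j))) (X $$ (i, k)))"
  using assms
  by (simp add: odot_def eval_tensor_sum eval_tensor_tensor lessThan_Suc_atMost del: sum.lessThan_Suc)

lemma eval_tensor_single [simp]: "eval_tensor \<phi> {#w#} = \<phi> w"
  by (simp add: eval_tensor_def)

lemma eval_tensor_empty [simp]: "eval_tensor \<phi> {#} = 0"
  by (simp add: eval_tensor_def)

lemma as_tensors_entry: "a \<in> carrier_mat n n \<Longrightarrow> i < n \<Longrightarrow> j < n \<Longrightarrow> as_tensors a $$ (i, j) = {#[a $$ (i, j)]#}"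
  by (simp add: as_tensors_def)

lemma as_tensors_carrier [simp]: "as_tensors a \<in> carrier_mat n k \<longleftrightarrow> a \<in> carrier_mat n k"
  by (simp add: as_tensors_def)

lemma odot_carrier:
  "X \<in> carrier_mat n n \<Longrightarrow> Y \<in> carrier_mat n n \<Longrightarrow> odot X Y \<in> carrier_mat n n"
  by (simp add: odot_def)

lemma odot_power_carrier: "a \<in> carrier_mat n n \<Longrightarrow> odot_power a k \<in> carrier_mat n n"
  by (induction k) (simp_all add: odot_carrier)

lemma Mat_plus_carrier: "a \<in> Mat_plus m \<Longrightarrow> a \<in> carrier_mat (m + 1) (m + 1)"
  by (simp add: Mat_plus_def)

text \<open>
  The words in a power of \<open>a\<close> belong to all sequences of indices.  Those of a sequence that is not
  increasing contain a zero entry and are killed by additivity; \<open>N\<close> steps suffice because the index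
  grows by at least one in each step.
\<close>

lemma sum_odot_powers:
  fixes \<phi> :: "'a::ab_group_add list \<Rightarrow> 'b::ab_group_add"
  assumes a: "a \<in> Mat_plus m" and "slot_additive \<phi>" "i \<le> m" "j \<le> m" "j \<le> i + N"
  shows "(\<Sum>n\<le>N. eval_tensor \<phi> (odot_power a n $$ (i, j))) = path_sum a i j \<phi>"
  using assms(2-5)
proof (induction N arbitrary: \<phi> i)
  case 0
  then show ?case
    using Mat_plus_carrier[OF a] by (subst path_sum.simps) auto
next
  case (Suc N)
  note car = Mat_plus_carrier[OF a]
  let ?e = "\<lambda>k n. eval_tensor (\<lambda>w. \<phi> (a $$ (i, k) # w)) (odot_power a n $$ (k, j))"
  have "eval_tensor \<phi> (odot_power a (Suc n) $$ (i, j)) = (\<Sum>k\<le>m. ?e k n)" for n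
    using Suc.prems eval_tensor_odot[OF _ odot_power_carrier[OF car], of "as_tensors a" i j \<phi> n] car
    by (simp add: as_tensors_entry)
  then have "(\<Sum>n\<le>Suc N. eval_tensor \<phi> (odot_power a n $$ (i, j))) =
      eval_tensor \<phi> (odot_power a 0 $$ (i, j)) + (\<Sum>n\<le>N. \<Sum>k\<le>m. ?e k n)"
    by (simp only: sum.atMost_Suc_shift)
  also have "eval_tensor \<phi> (odot_power a 0 $$ (i, j)) = (if i = j then \<phi> [] else 0)"
    using Suc.prems car by simp
  also have "(\<Sum>n\<le>N. \<Sum>k\<le>m. ?e k n) = (\<Sum>k\<le>m. \<Sum>n\<le>N. ?e k n)"
    by (rule sum.swap)
  also have "\<dots> = (\<Sum>k\<in>{i<..j}. path_sum a k j (\<lambda>w. \<phi> (a $$ (i, k) # w)))"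
  proof (rule sum.mono_neutral_cong_right)
    have IH: "(\<Sum>n\<le>N. ?e k n) = path_sum a k j (\<lambda>w. \<phi> (a $$ (i, k) # w))"
      if "k \<le> m" "i < k" for k
      using that Suc.prems by (intro Suc.IH slot_additive_Cons) auto
    then show "(\<Sum>n\<le>N. ?e k n) = path_sum a k j (\<lambda>w. \<phi> (a $$ (i, k) # w))"
      if "k \<in> {i<..j}" for k
      using that Suc.prems by auto
    show "\<forall>k\<in>{..m} - {i<..j}. (\<Sum>n\<le>N. ?e k n) = 0"
    proof
      fix k assume k: "k \<in> {..m} - {i<..j}"
      show "(\<Sum>n\<le>N. ?e k n) = 0"
      proof (cases "k \<le> i")
        case True
        then have "a $$ (i, k) = 0" using a Suc.prems by (auto simp: Mat_plus_def)
        then have "\<phi> (a $$ (i, k) # w) = 0" for w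
          using slot_additive_zero[OF Suc.prems(1)] by simp
        then show ?thesis by (simp add: eval_tensor_def)
      next
        case False
        then show ?thesis using k IH[of k] by (simp add: path_sum_above)
      qed
    qed
  qed (use Suc.prems in auto)
  finally show ?case by (subst path_sum.simps)
qed

lemma power_sum_entry:
  fixes h :: "'a::ab_group_add list \<Rightarrow> 'b::ab_group_add"
  assumes a: "a \<in> Mat_plus m" and h: "slot_additive h" and ij: "i \<le> m" "j \<le> m"
  shows "power_sum h a $$ (i, j) = (if i < j then path_sum a i j h else 0)"
proof -
  note car = Mat_plus_carrier[OF a]
  have "power_sum h a $$ (i, j) = (\<Sum>n = 1..m. eval_tensor h (odot_power a n $$ (i, j)))"
    using car ij carrier_matD[OF odot_power_carrier[OF car]]
    by (simp add: power_sum_def atLeastLessThanSuc_atLeastAtMost)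
  \<comment> \<open>The path sum also counts the zeroth power, which contributes on the diagonal only.\<close>
  then have "path_sum a i j h = eval_tensor h (odot_power a 0 $$ (i, j)) + power_sum h a $$ (i, j)"
    using sum_odot_powers[OF a h ij, of m] ij
    by (simp add: sum.atLeast_Suc_atMost flip: atLeast0AtMost)
  moreover have "eval_tensor h (odot_power a 0 $$ (i, j)) = (if i = j then h [] else 0)"
    using car ij by simp
  ultimately show ?thesis
    using path_sum_above[of j i a h] by (cases i j rule: linorder_cases) auto
qed

lemma power_sum_Mat_plus:
  assumes "a \<in> Mat_plus m" "slot_additive h"
  shows "power_sum h a \<in> Mat_plus m"
  using assms power_sum_entry[OF assms] Mat_plus_carrier[OF assms(1)]
  by (auto simp: Mat_plus_def[of m] power_sum_def)

lemma mixed_sum_entry: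
  fixes h :: "'a::ab_group_add list \<Rightarrow> 'b::ab_group_add"
  assumes h: "multilinear sA sB h"
    and a': "a' \<in> Mat_plus m" and c: "c \<in> Mat_plus m" and a: "a \<in> Mat_plus m"
    and ij: "i \<le> m" "j \<le> m"
  shows "mixed_sum h a' c a $$ (i, j) =
    (\<Sum>k\<in>{i..j}. \<Sum>l\<in>{k<..j}.
       path_sum a' i k (\<lambda>u. path_sum a l j (\<lambda>v. h (u @ c $$ (k, l) # v))))"
proof -
  note car = Mat_plus_carrier[OF a'] Mat_plus_carrier[OF c] Mat_plus_carrier[OF a]
  note sa = multilinear_slot_additive[OF h]
  let ?M = "\<lambda>r t. odot (odot (odot_power a' r) (as_tensors c)) (odot_power a t)"
  let ?E = "\<lambda>r t. map_mat (eval_tensor h) (?M r t) $$ (i, j)"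
  let ?P = "\<lambda>k l. path_sum a' i k (\<lambda>u. path_sum a l j (\<lambda>v. h (u @ c $$ (k, l) # v)))"
  have M: "?M r t \<in> carrier_mat (m + 1) (m + 1)" for r t
    using car by (intro odot_carrier odot_power_carrier) auto
  have E: "?E r t = (\<Sum>l\<le>m. \<Sum>k\<le>m.
      eval_tensor (\<lambda>u. eval_tensor (\<lambda>v. h (u @ c $$ (k, l) # v)) (odot_power a t $$ (l, j)))
        (odot_power a' r $$ (i, k)))" for r t
  proof -
    have "?E r t = eval_tensor h (?M r t $$ (i, j))"
      using M[of r t] ij by simp
    also have "\<dots> = (\<Sum>l\<le>m. eval_tensor (\<lambda>u. eval_tensor (\<lambda>v. h (u @ v)) (odot_power a t $$ (l, j)))
        (odot (odot_power a' r) (as_tensors c) $$ (i, l)))"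
      using car ij by (intro eval_tensor_odot odot_carrier odot_power_carrier) auto
    also have "\<dots> = (\<Sum>l\<le>m. \<Sum>k\<le>m.
      eval_tensor (\<lambda>u. eval_tensor (\<lambda>v. h (u @ c $$ (k, l) # v)) (odot_power a t $$ (l, j)))
        (odot_power a' r $$ (i, k)))"
    proof (rule sum.cong[OF refl])
      fix l assume "l \<in> {..m}"
      then show "eval_tensor (\<lambda>u. eval_tensor (\<lambda>v. h (u @ v)) (odot_power a t $$ (l, j)))
          (odot (odot_power a' r) (as_tensors c) $$ (i, l)) =
        (\<Sum>k\<le>m. eval_tensor (\<lambda>u. eval_tensor (\<lambda>v. h (u @ c $$ (k, l) # v)) (odot_power a t $$ (l, j)))
          (odot_power a' r $$ (i, k)))"
        using car ij
        by (subst eval_tensor_odot[of _ m]) (auto simp: as_tensors_entry intro: odot_power_carrier)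
    qed
    finally show ?thesis .
  qed
  have swap: "(\<Sum>r\<le>m. \<Sum>t\<le>m. \<Sum>l\<le>m. \<Sum>k\<le>m. q r t l k) =
      (\<Sum>l\<le>m. \<Sum>k\<le>m. \<Sum>r\<le>m. \<Sum>t\<le>m. q r t l k)" for q :: "nat \<Rightarrow> nat \<Rightarrow> nat \<Rightarrow> nat \<Rightarrow> 'b"
  proof -
    have "(\<Sum>r\<le>m. \<Sum>t\<le>m. \<Sum>l\<le>m. \<Sum>k\<le>m. q r t l k) = (\<Sum>r\<le>m. \<Sum>l\<le>m. \<Sum>t\<le>m. \<Sum>k\<le>m. q r t l k)"
      by (intro sum.cong refl sum.swap)
    also have "\<dots> = (\<Sum>l\<le>m. \<Sum>r\<le>m. \<Sum>t\<le>m. \<Sum>k\<le>m. q r t l k)"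
      by (rule sum.swap)
    also have "\<dots> = (\<Sum>l\<le>m. \<Sum>r\<le>m. \<Sum>k\<le>m. \<Sum>t\<le>m. q r t l k)"
      by (intro sum.cong refl sum.swap)
    also have "\<dots> = (\<Sum>l\<le>m. \<Sum>k\<le>m. \<Sum>r\<le>m. \<Sum>t\<le>m. q r t l k)"
      by (intro sum.cong refl sum.swap)
    finally show ?thesis .
  qed
  have "mixed_sum h a' c a $$ (i, j) = (\<Sum>(r, t) \<in> {(r, t). r + 1 + t < m + 1}. ?E r t)"
    using car ij by (simp add: mixed_sum_def)
  \<comment> \<open>Allowing \<open>r\<close> and \<open>t\<close> to range independently adds zero matrices only, and decouples the two powers.\<close>
  also have "\<dots> = (\<Sum>(r, t) \<in> {..m} \<times> {..m}. ?E r t)"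
  proof (rule sum.mono_neutral_left)
    have "?E r t = 0" if "\<not> r + 1 + t < m + 1" for r t
      using odot_mixed_vanishes[OF h a a' c, of r t] that ij by simp
    then show "\<forall>q\<in>{..m} \<times> {..m} - {(r, t). r + 1 + t < m + 1}. (case q of (r, t) \<Rightarrow> ?E r t) = 0"
      by auto
  qed auto
  also have "\<dots> = (\<Sum>r\<le>m. \<Sum>t\<le>m. ?E r t)"
    by (simp add: sum.cartesian_product)
  also have "\<dots> = (\<Sum>l\<le>m. \<Sum>k\<le>m. \<Sum>r\<le>m. \<Sum>t\<le>m.
      eval_tensor (\<lambda>u. eval_tensor (\<lambda>v. h (u @ c $$ (k, l) # v)) (odot_power a t $$ (l, j)))
        (odot_power a' r $$ (i, k)))"
    unfolding E by (rule swap)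
  also have "\<dots> = (\<Sum>l\<le>m. \<Sum>k\<le>m. ?P k l)"
  proof (intro sum.cong refl)
    fix l k assume lk: "l \<in> {..m}" "k \<in> {..m}"
    have inner: "(\<Sum>t\<le>m. eval_tensor (\<lambda>v. h (u @ c $$ (k, l) # v)) (odot_power a t $$ (l, j))) =
        path_sum a l j (\<lambda>v. h (u @ c $$ (k, l) # v))" for u
      using sa lk ij by (intro sum_odot_powers[OF a] slot_additive_append slot_additive_Cons) auto
    have "slot_additive (\<lambda>u. path_sum a l j (\<lambda>v. h (u @ c $$ (k, l) # v)))"
      unfolding slot_additive_def
      by (intro allI Modules.additive.intro) (simp add: slot_additive_add[OF sa] path_sum_distrib)
    then show "(\<Sum>r\<le>m. \<Sum>t\<le>m.
        eval_tensor (\<lambda>u. eval_tensor (\<lambda>v. h (u @ c $$ (k, l) # v)) (odot_power a t $$ (l, j)))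
          (odot_power a' r $$ (i, k))) = ?P k l"
      unfolding sum_eval_tensor inner using lk ij by (intro sum_odot_powers[OF a']) auto
  qed
  also have "\<dots> = (\<Sum>k\<le>m. \<Sum>l\<le>m. ?P k l)"
    by (rule sum.swap)
  also have "\<dots> = (\<Sum>k\<in>{i..j}. \<Sum>l\<in>{k<..j}. ?P k l)"
  proof -
    have zero: "?P k l = 0" if "k \<le> m" "l \<le> m" "\<not> (i \<le> k \<and> k < l \<and> l \<le> j)" for k l
    proof (cases "l \<le> k")
      case True
      then have "c $$ (k, l) = 0" using c that by (auto simp: Mat_plus_def)
      then show ?thesis using slot_additive_zero[OF sa] by simp
    next
      case False
      then show ?thesis using that by (auto simp: path_sum_above not_le)
    qed
    have "(\<Sum>l\<le>m. ?P k l) = (\<Sum>l\<in>{k<..j}. ?P k l)" if "k \<in> {i..j}" for k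
      using that ij zero by (intro sum.mono_neutral_right) auto
    then show ?thesis
      using ij by (intro sum.mono_neutral_cong_right) (auto intro!: sum.neutral zero)
  qed
  finally show ?thesis .
qed

section \<open>Gradings and signs\<close>

lemma sgn_by_additive: "Modules.additive (sgn_by d)"
  by (intro Modules.additive.intro) (simp add: sgn_by_def)

lemma additive_sgn_by: "Modules.additive D \<Longrightarrow> D (sgn_by d x) = sgn_by d (D x)"
  by (simp add: sgn_by_def Modules.additive.minus)

lemma sgn_by_sum: "sgn_by (d + e) x = sgn_by d (sgn_by e x)"
  by (simp add: sgn_by_def)

lemma homogeneous_append:
  assumes "homogeneous gr ds (us @ ws)"
  shows "homogeneous gr (take (length us) ds) us" "homogeneous gr (drop (length us) ds) ws"
  using assms by (auto simp: homogeneous_def list_all2_append2 list_all2_lengthD)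

context graded_vector_space
begin

definition component :: "'a \<Rightarrow> 'd \<Rightarrow> 'a" where
  "component x = (THE c. is_decomposition gr x c)"

lemma component_decomposition: "is_decomposition gr x (component x)"
  unfolding component_def by (rule theI'[OF ex1_decomposition])

lemma component_unique: "is_decomposition gr x c \<Longrightarrow> component x = c"
  using ex1_decomposition component_decomposition by blast

lemma component_in_gr: "component x d \<in> gr d"
  and finite_components: "finite {d. component x d \<noteq> 0}"
  and sum_components: "x = (\<Sum>d | component x d \<noteq> 0. component x d)"
  using component_decomposition[of x] by (simp_all add: is_decomposition_def)

lemma component_add: "component (x + y) d = component x d + component y d"
proof -
  let ?S = "{d. component x d \<noteq> 0} \<union> {d. component y d \<noteq> 0}"
  let ?c = "\<lambda>d. component x d + component y d"
  have fin: "finite ?S" by (simp add: finite_components)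
  have "x = sum (component x) ?S" and "y = sum (component y) ?S"
    by (rule trans[OF sum_components sum.mono_neutral_left]; use fin in auto)+
  then have "x + y = sum (component x) ?S + sum (component y) ?S"
    by (rule arg_cong2)
  also have "\<dots> = sum ?c ?S"
    by (rule sum.distrib[symmetric])
  also have "\<dots> = sum ?c {d. ?c d \<noteq> 0}"
    by (rule sum.mono_neutral_right) (use fin in auto)
  finally have "is_decomposition gr (x + y) ?c"
    using subspace_add[OF subspace_gr component_in_gr component_in_gr]
    by (auto simp: is_decomposition_def intro: finite_subset[OF _ fin])
  then show ?thesis by (simp add: component_unique)
qed

lemma component_homogeneous: "x \<in> gr d \<Longrightarrow> component x = (\<lambda>e. if e = d then x else 0)"
  by (rule component_unique)
     (cases "x = 0"; simp add: is_decomposition_def subspace_0[OF subspace_gr])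

text \<open>
  A common finite index set is needed to compare the bars of several elements.
\<close>

lemma bar_eq:
  assumes "finite S" "{d. component x d \<noteq> 0} \<subseteq> S"
  shows "bar gr x = (\<Sum>d\<in>S. sgn_by d (component x d))"
  unfolding bar_def component_def[symmetric] Let_def
  by (rule sum.mono_neutral_left) (use assms in \<open>auto simp: sgn_by_def\<close>)

lemma bar_additive: "Modules.additive (bar gr)"
proof
  fix x y
  let ?S = "{d. component x d \<noteq> 0} \<union> {d. component y d \<noteq> 0}"
  have "finite ?S" by (simp add: finite_components)
  then show "bar gr (x + y) = bar gr x + bar gr y"
    by (subst (1 2 3) bar_eq[of ?S])
       (auto simp: component_add Modules.additive.add[OF sgn_by_additive] sum.distrib)
qed

lemma bar_homogeneous: "x \<in> gr d \<Longrightarrow> bar gr x = sgn_by d x"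
  by (subst bar_eq[of "{d}"]) (auto simp: component_homogeneous)

lemma slot_additive_bar: "slot_additive h \<Longrightarrow> slot_additive (\<lambda>us. h (map (bar gr) us @ ws))"
  unfolding slot_additive_def[of "\<lambda>us. h (map (bar gr) us @ ws)"]
  by (intro allI Modules.additive.intro)
     (simp add: Modules.additive.add[OF bar_additive] slot_additive_add)

text \<open>
  Each entry is the sum of its homogeneous components, so the entries may be made homogeneous one at
  a time.  The induction removes them from the right end of the prefix \<open>us\<close> of arbitrary elements.
\<close>

lemma slot_additive_eq_0:
  assumes E: "slot_additive E"
    and hom: "\<And>ds xs. xs \<noteq> [] \<Longrightarrow> homogeneous gr ds xs \<Longrightarrow> E xs = 0"
    and "xs \<noteq> []"
  shows "E xs = 0"
proof -
  have "E (us @ ws) = 0" if "homogeneous gr ds ws" "us @ ws \<noteq> []" for us ws ds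
    using that
  proof (induction us arbitrary: ws ds rule: rev_induct)
    case Nil
    then show ?case using hom by simp
  next
    case (snoc x us)
    have "E (us @ component x d # ws) = 0" for d
      using snoc.prems component_in_gr by (intro snoc.IH[of "d # ds"]) (auto simp: homogeneous_def)
    then have "E (us @ (\<Sum>d | component x d \<noteq> 0. component x d) # ws) = 0"
      by (simp add: Modules.additive.sum[OF slot_additiveD[OF E]])
    then show ?case using sum_components[of x] by simp
  qed
  from this[of "[]" "[]" xs] show ?thesis using assms(3) by (simp add: homogeneous_def)
qed

text \<open>
  Barring the arguments produces the Koszul sign of a map of odd degree moved past them.
\<close>

lemma map_bar_homogeneous:
  assumes "slot_additive h" "homogeneous gr ds us"
  shows "h (map (bar gr) us @ ws) = sgn_by (sum_list ds) (h (us @ ws))"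
  using assms
proof (induction us arbitrary: h ds)
  case Nil
  then show ?case by (simp add: homogeneous_def sgn_by_def)
next
  case (Cons x us)
  then obtain d ds' where ds: "ds = d # ds'" "x \<in> gr d" "homogeneous gr ds' us"
    by (auto simp: homogeneous_def list_all2_Cons2)
  have "h (map (bar gr) (x # us) @ ws) = sgn_by d (h (x # map (bar gr) us @ ws))"
    using additive_sgn_by[OF slot_additiveD[OF Cons.prems(1), of "[]"]] ds
    by (simp add: bar_homogeneous)
  also have "h (x # map (bar gr) us @ ws) = sgn_by (sum_list ds') (h (x # us @ ws))"
    using Cons.IH[OF slot_additive_Cons[OF Cons.prems(1)] ds(3)] .
  finally show ?case by (simp add: ds sgn_by_sum)
qed

lemma insertion_sum_homogeneous:
  assumes "slot_additive h" "homogeneous gr ds xs"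
  shows "insertion_sum h b ds xs = infix_sum b (\<lambda>us z ws. h (map (bar gr) us @ z # ws)) xs"
  unfolding insertion_sum_def infix_sum_def
  by (intro sum.cong) (use assms homogeneous_append(1) in \<open>force simp: map_bar_homogeneous\<close>)+

lemma slot_additive_insertion:
  assumes "slot_additive h" "slot_additive b"
  shows "slot_additive (infix_sum b (\<lambda>us z ws. h (map (bar gr) us @ z # ws)))"
  using assms
  by (intro slot_additive_infix_sum slot_additive_bar slot_additiveD slot_additive_append slot_additive_Cons)

end

text \<open>
  Since \<open>g\<close> has degree zero, barring its value on a block gives the sign of the degrees in that block.
\<close>

lemma map_bar_blocks_homogeneous:
  assumes "graded_vector_space sB gB" and g: "has_degree gA gB 0 g"
    and "slot_additive h" "homogeneous gA ds (concat uss)" "[] \<notin> set uss"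
  shows "h (map (bar gB \<circ> g) uss @ ws) = sgn_by (sum_list ds) (h (map g uss @ ws))"
  using assms(3-5)
proof (induction uss arbitrary: h ds)
  case Nil
  then show ?case by (simp add: homogeneous_def sgn_by_def)
next
  case (Cons us uss)
  interpret graded_vector_space sB gB by fact
  let ?d = "sum_list (take (length us) ds)" and ?ds' = "drop (length us) ds"
  have hom: "homogeneous gA (take (length us) ds) us" "homogeneous gA ?ds' (concat uss)"
    using homogeneous_append Cons.prems(2) by auto
  then have "g us \<in> gB ?d"
    using g Cons.prems(3) unfolding has_degree_def by (metis add_0_right list.set_intros(1))
  then have "h (map (bar gB \<circ> g) (us # uss) @ ws) = sgn_by ?d (h (g us # map (bar gB \<circ> g) uss @ ws))"
    using additive_sgn_by[OF slot_additiveD[OF Cons.prems(1), of "[]"]]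
    by (simp add: bar_homogeneous)
  also have "h (g us # map (bar gB \<circ> g) uss @ ws) = sgn_by (sum_list ?ds') (h (g us # map g uss @ ws))"
    by (rule Cons.IH[OF slot_additive_Cons[OF Cons.prems(1)] hom(2)]) (use Cons.prems(3) in simp)
  also have "sgn_by ?d (sgn_by (sum_list ?ds') (h (g us # map g uss @ ws))) =
      sgn_by (sum_list ds) (h (g us # map g uss @ ws))"
    by (metis append_take_drop_id sgn_by_sum sum_list_append)
  finally show ?case by simp
qed

section \<open>The structure relations on arbitrary elements\<close>

locale two_a_infinity_algebras =
  A: a_infinity_algebra sA gA bA + B: a_infinity_algebra sB gB bB
  for sA :: "'k::field \<Rightarrow> 'a::ab_group_add \<Rightarrow> 'a" and gA :: "'d::ring_parity \<Rightarrow> 'a set" and bA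
    and sB :: "'k \<Rightarrow> 'b::ab_group_add \<Rightarrow> 'b" and gB :: "'d \<Rightarrow> 'b set" and bB

context a_infinity_algebra
begin

lemma slot_additive_b: "slot_additive b"
  using multilinear_b by (rule multilinear_slot_additive)

lemma b_additive: "Modules.additive (\<lambda>x. b [x])"
  using slot_additiveD[OF slot_additive_b, of "[]" "[]"] by simp

lemma a_infinity_relation_bar:
  assumes "xs \<noteq> []"
  shows "infix_sum b (\<lambda>us z ws. b (map (bar gr) us @ z # ws)) xs = 0"
  by (rule slot_additive_eq_0[OF slot_additive_insertion[OF slot_additive_b slot_additive_b] _ assms])
     (simp add: a_infinity_relation flip: insertion_sum_homogeneous[OF slot_additive_b])

text \<open>
  Of the steps replaced by entries of \<open>\<partial>a\<close> only \<open>(0, m)\<close> survives, and it leaves no room for further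
  steps.
\<close>

lemma path_sum_insertion:
  assumes a: "a \<in> Mat_plus m" and h: "slot_additive h"
    and closed: "approx m (power_sum b a) (0\<^sub>m (m + 1) (m + 1))" and ij: "i < j" "j \<le> m"
  shows "path_sum a i j (infix_sum b (\<lambda>us z ws. h (map (bar gr) us @ z # ws))) =
    (if (i, j) = (0, m) then h [massey_cocycle m b a] else 0)"
proof -
  let ?D = "\<lambda>k l. path_sum a k l b"
  let ?T = "\<lambda>k l. path_sum a i k (\<lambda>us. path_sum a l j (\<lambda>ws. h (map (bar gr) us @ ?D k l # ws)))"
  have "path_sum a i j (infix_sum b (\<lambda>us z ws. h (map (bar gr) us @ z # ws))) =
      (\<Sum>k\<in>{i..j}. \<Sum>l\<in>{k<..j}. ?T k l)"
    by (rule path_sum_infix_sum) (rule slot_additiveD[OF h])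
  also have "\<dots> = (\<Sum>k\<in>{i..j}. \<Sum>l\<in>{k<..j}.
      if k = 0 \<and> l = m then h [massey_cocycle m b a] else 0)"
  proof (intro sum.cong refl)
    fix k l assume kl: "k \<in> {i..j}" "l \<in> {k<..j}"
    have D: "?D k l = power_sum b a $$ (k, l)"
      using kl ij by (subst power_sum_entry[OF a slot_additive_b]) auto
    show "?T k l = (if k = 0 \<and> l = m then h [massey_cocycle m b a] else 0)"
    proof (cases "k = 0 \<and> l = m")
      case True
      then have "i = 0" "j = m" using kl ij by auto
      then show ?thesis using True D by (simp add: massey_cocycle_def)
    next
      case False
      then have "?D k l = 0"
        unfolding D using closed kl ij by (auto simp: approx_def)
      then show ?thesis using False slot_additive_zero[OF h] by auto
    qed
  qed
  also have "\<dots> = (if (i, j) = (0, m) then h [massey_cocycle m b a] else 0)"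
  proof (cases "(i, j) = (0, m)")
    case True
    have "(\<Sum>k\<in>{i..j}. \<Sum>l\<in>{k<..j}. if k = 0 \<and> l = m then h [massey_cocycle m b a] else 0) =
        (\<Sum>k\<in>{i..j}. if k = 0 then h [massey_cocycle m b a] else 0)"
      using True ij by (intro sum.cong refl) auto
    then show ?thesis using True by simp
  qed (use ij in \<open>auto intro!: sum.neutral\<close>)
  finally show ?thesis .
qed

text \<open>
  Summing the algebra relation over the paths from \<open>0\<close> to \<open>m\<close> leaves \<open>b [\<mu>] = 0\<close>.
\<close>

lemma massey_cocycle_closed:
  assumes "a \<in> Mat_plus m" "approx m (power_sum b a) (0\<^sub>m (m + 1) (m + 1))" "0 < m"
  shows "b [massey_cocycle m b a] = 0"
proof -
  have "b [massey_cocycle m b a] =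
      path_sum a 0 m (infix_sum b (\<lambda>us z ws. b (map (bar gr) us @ z # ws)))"
    using assms by (simp add: path_sum_insertion[OF _ slot_additive_b])
  also have "\<dots> = path_sum a 0 m (\<lambda>w. 0)"
    using assms(3) by (intro path_sum_cong a_infinity_relation_bar)
  finally show ?thesis by simp
qed

end

context two_a_infinity_algebras
begin

lemma morphism_slot_additive:
  "a_infinity_morphism sA gA bA sB gB bB f \<Longrightarrow> slot_additive f"
  by (auto simp: a_infinity_morphism_def intro: multilinear_slot_additive)

lemma homotopy_slot_additive:
  "a_infinity_homotopy sA gA bA sB gB bB f g \<eta> \<Longrightarrow> slot_additive \<eta>"
  by (auto simp: a_infinity_homotopy_def intro: multilinear_slot_additive)

lemma morphism_relation_bar:
  assumes f: "a_infinity_morphism sA gA bA sB gB bB f" and "xs \<noteq> []"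
  shows "infix_sum bA (\<lambda>us z ws. f (map (bar gA) us @ z # ws)) xs = cut_sum bB f xs"
proof -
  note sa = morphism_slot_additive[OF f]
  have "infix_sum bA (\<lambda>us z ws. f (map (bar gA) us @ z # ws)) xs - cut_sum bB f xs = 0"
  proof (rule A.slot_additive_eq_0[OF _ _ assms(2)])
    show "slot_additive
        (\<lambda>xs. infix_sum bA (\<lambda>us z ws. f (map (bar gA) us @ z # ws)) xs - cut_sum bB f xs)"
      by (intro slot_additive_diff A.slot_additive_insertion slot_additive_cut_sum sa
          A.slot_additive_b B.slot_additive_b)
    show "infix_sum bA (\<lambda>us z ws. f (map (bar gA) us @ z # ws)) xs - cut_sum bB f xs = 0"
      if "xs \<noteq> []" "homogeneous gA ds xs" for ds xs
      using f that by (simp add: a_infinity_morphism_def cut_sum_def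
          flip: A.insertion_sum_homogeneous[OF sa])
  qed
  then show ?thesis by simp
qed

text \<open>
  The terms $b^B_{r+1+t}\circ(g_{i_1}\otimes\cdots\otimes g_{i_r}\otimes z\otimes
  f_{j_1}\otimes\cdots\otimes f_{j_t})$, summed over all cuts of the words to the left and to the right
  of \<open>z\<close>.  The bars on the values of \<open>g\<close> account for the sign of moving \<open>\<eta>\<close> past the left word.
\<close>

definition homotopy_terms ::
  "('a list \<Rightarrow> 'b) \<Rightarrow> ('a list \<Rightarrow> 'b) \<Rightarrow> 'a list \<Rightarrow> 'b \<Rightarrow> 'a list \<Rightarrow> 'b" where
  "homotopy_terms f g us z ws =
     cut_sum (\<lambda>U. cut_sum (\<lambda>W. bB (U @ z # W)) f ws) (bar gB \<circ> g) us"

text \<open>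
  The triples of two lists of blocks and an infix are grouped by the splitting of the word that they
  induce.
\<close>

lemma homotopy_sum_homogeneous:
  assumes g: "has_degree gA gB 0 g" and hom: "homogeneous gA ds xs"
  shows "(\<Sum>(uss, vs, wss) \<in> {(uss, vs, wss). concat uss @ vs @ concat wss = xs \<and>
                 vs \<noteq> [] \<and> [] \<notin> set uss \<and> [] \<notin> set wss}.
             sgn_by (- 1 * sum_list (take (length (concat uss)) ds))
               (bB (map g uss @ \<eta> vs # map f wss))) =
    infix_sum \<eta> (homotopy_terms f g) xs"
proof -
  let ?C = "\<lambda>xs. {yss. concat yss = xs \<and> [] \<notin> set yss}"
  let ?T = "{(us, vs, ws). us @ vs @ ws = xs \<and> vs \<noteq> []}"
  let ?B = "\<lambda>uss vs wss. bB (map (bar gB \<circ> g) uss @ \<eta> vs # map f wss)"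
  have fin: "finite ?T"
    by (rule finite_subset[OF _ finite_triple_splits[of xs]]) auto
  have "infix_sum \<eta> (homotopy_terms f g) xs =
      (\<Sum>q\<in>?T. \<Sum>p\<in>?C (fst q) \<times> ?C (snd (snd q)). ?B (fst p) (fst (snd q)) (snd p))"
    by (simp add: infix_sum_def homotopy_terms_def cut_sum_def sum.cartesian_product
        case_prod_unfold)
  also have "\<dots> = (\<Sum>(q, p) \<in> (SIGMA q:?T. ?C (fst q) \<times> ?C (snd (snd q))).
      ?B (fst p) (fst (snd q)) (snd p))"
    using fin by (intro sum.Sigma ballI finite_cartesian_product finite_cuts)
  also have "\<dots> = (\<Sum>(uss, vs, wss) \<in> {(uss, vs, wss). concat uss @ vs @ concat wss = xs \<and>
      vs \<noteq> [] \<and> [] \<notin> set uss \<and> [] \<notin> set wss}. ?B uss vs wss)"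
    by (rule sum.reindex_bij_witness
        [where i = "\<lambda>(uss, vs, wss). ((concat uss, vs, concat wss), (uss, wss))"
           and j = "\<lambda>(q, p). (fst p, fst (snd q), snd p)"]) auto
  also have "\<dots> = (\<Sum>(uss, vs, wss) \<in> {(uss, vs, wss). concat uss @ vs @ concat wss = xs \<and>
                 vs \<noteq> [] \<and> [] \<notin> set uss \<and> [] \<notin> set wss}.
             sgn_by (- 1 * sum_list (take (length (concat uss)) ds))
               (bB (map g uss @ \<eta> vs # map f wss)))"
  proof (intro sum.cong refl, clarify)
    fix uss vs wss
    assume xs: "xs = concat uss @ vs @ concat wss" and uss: "[] \<notin> set uss"
    have "homogeneous gA (take (length (concat uss)) ds) (concat uss)"
      using hom homogeneous_append(1) unfolding xs by blast
    from map_bar_blocks_homogeneous[OF B.graded_vector_space_axioms g B.slot_additive_b this uss]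
    show "?B uss vs wss = sgn_by (- 1 * sum_list (take (length (concat uss)) ds))
        (bB (map g uss @ \<eta> vs # map f wss))"
      by (simp add: sgn_by_def)
  qed
  finally show ?thesis by simp
qed

lemma homotopy_terms_additive:
  assumes "slot_additive f" "slot_additive g"
  shows "slot_additive (\<lambda>us. homotopy_terms f g us z ws)"
    and "Modules.additive (\<lambda>z. homotopy_terms f g us z ws)"
    and "slot_additive (homotopy_terms f g us z)"
proof -
  have "slot_additive (bar gB \<circ> g)"
    using assms(2) by (simp add: slot_additive_def Modules.additive_def
        Modules.additive.add[OF B.bar_additive])
  moreover have "slot_additive (\<lambda>U. cut_sum (\<lambda>W. bB (U @ z # W)) f ws)"
    unfolding cut_sum_def
    by (intro slot_additive_sum slot_additive_before B.slot_additive_b)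
  ultimately show "slot_additive (\<lambda>us. homotopy_terms f g us z ws)"
    unfolding homotopy_terms_def by (rule slot_additive_cut_sum[rotated])
  show "Modules.additive (\<lambda>z. homotopy_terms f g us z ws)"
    unfolding homotopy_terms_def cut_sum_def
    by (intro Modules.additive.intro) (simp add: slot_additive_add[OF B.slot_additive_b] sum.distrib)
  show "slot_additive (homotopy_terms f g us z)"
    unfolding homotopy_terms_def[abs_def] cut_sum_def[of _ "bar gB \<circ> g"]
    by (intro slot_additive_sum slot_additive_cut_sum slot_additive_append slot_additive_Cons
        B.slot_additive_b assms)
qed

lemma homotopy_relation_bar:
  assumes f: "a_infinity_morphism sA gA bA sB gB bB f"
    and g: "a_infinity_morphism sA gA bA sB gB bB g"
    and \<eta>: "a_infinity_homotopy sA gA bA sB gB bB f g \<eta>" and "xs \<noteq> []"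
  shows "g xs - f xs = infix_sum \<eta> (homotopy_terms f g) xs +
    infix_sum bA (\<lambda>us z ws. \<eta> (map (bar gA) us @ z # ws)) xs"
proof -
  note sa = morphism_slot_additive[OF f] morphism_slot_additive[OF g] homotopy_slot_additive[OF \<eta>]
  let ?R = "\<lambda>xs. infix_sum \<eta> (homotopy_terms f g) xs +
    infix_sum bA (\<lambda>us z ws. \<eta> (map (bar gA) us @ z # ws)) xs"
  have "(g xs - f xs) - ?R xs = 0"
  proof (rule A.slot_additive_eq_0[OF _ _ assms(4)])
    show "slot_additive (\<lambda>xs. (g xs - f xs) - ?R xs)"
      by (intro slot_additive_diff slot_additive_plus slot_additive_infix_sum
          homotopy_terms_additive A.slot_additive_insertion sa A.slot_additive_b)
    show "(g xs - f xs) - ?R xs = 0" if "xs \<noteq> []" "homogeneous gA ds xs" for ds xs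
    proof -
      have "has_degree gA gB 0 g" using g by (simp add: a_infinity_morphism_def)
      then show ?thesis
        using \<eta> that unfolding a_infinity_homotopy_def
        by (simp flip: A.insertion_sum_homogeneous[OF sa(3)] homotopy_sum_homogeneous)
    qed
  qed
  then show ?thesis by simp
qed

section \<open>Defining systems under morphisms and homotopies\<close>

lemma power_sum_morphism:
  assumes f: "a_infinity_morphism sA gA bA sB gB bB f" and a: "a \<in> Mat_plus m"
    and closed: "approx m (power_sum bA a) (0\<^sub>m (m + 1) (m + 1))" and ij: "i < j" "j \<le> m"
  shows "power_sum bB (power_sum f a) $$ (i, j) =
    (if (i, j) = (0, m) then f [massey_cocycle m bA a] else 0)"
proof -
  note sa = morphism_slot_additive[OF f]
  have "power_sum bB (power_sum f a) $$ (i, j) = path_sum (power_sum f a) i j bB"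
    using ij by (simp add: power_sum_entry[OF power_sum_Mat_plus[OF a sa] B.slot_additive_b])
  also have "\<dots> = path_sum a i j (cut_sum bB f)"
    using ij power_sum_entry[OF a sa]
    by (intro path_sum_cut_sum[symmetric] B.slot_additive_b) auto
  also have "\<dots> = path_sum a i j (infix_sum bA (\<lambda>us z ws. f (map (bar gA) us @ z # ws)))"
    using ij by (intro path_sum_cong morphism_relation_bar[OF f, symmetric]) auto
  finally show ?thesis
    using A.path_sum_insertion[OF a sa closed ij] by simp
qed

lemma massey_cocycle_morphism:
  assumes "a_infinity_morphism sA gA bA sB gB bB f" "a \<in> Mat_plus m"
    and "approx m (power_sum bA a) (0\<^sub>m (m + 1) (m + 1))" "0 < m"
  shows "massey_cocycle m bB (power_sum f a) = f [massey_cocycle m bA a]"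
  using power_sum_morphism[OF assms(1-3), of 0 m] assms(4)
  by (simp add: massey_cocycle_def[of _ bB])

text \<open>
  The cuts to the left and to the right of the infix are resummed as in \<open>path_sum_cut_sum\<close>, the infix
  itself as in \<open>path_sum_infix_sum\<close>.  The right-hand side is an entry of a \<^const>\<open>mixed_sum\<close>.
\<close>

lemma path_sum_homotopy_terms:
  assumes f: "slot_additive f" and g: "slot_additive g" and \<eta>: "slot_additive \<eta>"
    and a: "a \<in> Mat_plus m" and j: "j \<le> m"
  shows "path_sum a i j (infix_sum \<eta> (homotopy_terms f g)) =
    (\<Sum>k\<in>{i..j}. \<Sum>l\<in>{k<..j}.
       path_sum (map_mat (bar gB) (power_sum g a)) i k
         (\<lambda>u. path_sum (power_sum f a) l j (\<lambda>v. bB (u @ power_sum \<eta> a $$ (k, l) # v))))"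
proof -
  let ?F = "power_sum f a" and ?G = "map_mat (bar gB) (power_sum g a)"
  have F: "?F $$ (k, l) = path_sum a k l f" if "k < l" "l \<le> j" for k l
    using that j by (simp add: power_sum_entry[OF a f])
  have G: "?G $$ (k, l) = path_sum a k l (bar gB \<circ> g)" if "k < l" "l \<le> j" for k l
  proof -
    have "?G $$ (k, l) = bar gB (path_sum a k l g)"
      using that j Mat_plus_carrier[OF power_sum_Mat_plus[OF a g]]
      by (simp add: power_sum_entry[OF a g])
    then show ?thesis
      using path_sum_additive[OF B.bar_additive, of a k l g] by (simp add: o_def)
  qed
  have terms: "path_sum a i k (\<lambda>us. path_sum a l j (homotopy_terms f g us z)) =
      path_sum ?G i k (\<lambda>u. path_sum ?F l j (\<lambda>v. bB (u @ z # v)))" if "k \<le> j" for k l z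
  proof -
    let ?\<phi> = "\<lambda>u. path_sum ?F l j (\<lambda>v. bB (u @ z # v))"
    have "path_sum a l j (homotopy_terms f g us z) = cut_sum ?\<phi> (bar gB \<circ> g) us" for us
    proof -
      have "path_sum a l j (cut_sum (\<lambda>v. bB (u @ z # v)) f) = ?\<phi> u" for u
        using F by (intro path_sum_cut_sum slot_additive_append slot_additive_Cons B.slot_additive_b) auto
      then show ?thesis
        unfolding homotopy_terms_def[abs_def] cut_sum_def[of _ "bar gB \<circ> g"]
        by (simp add: path_sum_sum)
    qed
    moreover have "slot_additive ?\<phi>"
      unfolding slot_additive_def
      by (intro allI Modules.additive.intro)
         (simp add: slot_additive_add[OF B.slot_additive_b] path_sum_distrib)
    ultimately show ?thesis
      using that G by (simp add: path_sum_cut_sum[of ?\<phi>, where F = ?G])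
  qed
  have "power_sum \<eta> a $$ (k, l) = path_sum a k l \<eta>" if "k < l" "l \<le> j" for k l
    using that j by (simp add: power_sum_entry[OF a \<eta>])
  then show ?thesis
    unfolding path_sum_infix_sum[OF homotopy_terms_additive(2)[OF f g]]
    by (intro sum.cong refl) (simp add: terms)
qed

text \<open>
  The homotopy relation, summed over paths.  The corner is excluded because there the terms
  containing \<open>bA\<close> contribute \<open>\<eta> [\<mu>]\<close>.
\<close>

lemma power_sum_homotopy:
  assumes f: "a_infinity_morphism sA gA bA sB gB bB f"
    and g: "a_infinity_morphism sA gA bA sB gB bB g"
    and \<eta>: "a_infinity_homotopy sA gA bA sB gB bB f g \<eta>"
    and a: "a \<in> Mat_plus m" and closed: "approx m (power_sum bA a) (0\<^sub>m (m + 1) (m + 1))"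
  shows "approx m (power_sum g a - power_sum f a)
    (mixed_sum bB (map_mat (bar gB) (power_sum g a)) (power_sum \<eta> a) (power_sum f a))"
  unfolding approx_def
proof (intro allI impI)
  fix i j assume ij: "i \<le> m" "j \<le> m" "(i, j) \<noteq> (0, m)"
  note sa = morphism_slot_additive[OF f] morphism_slot_additive[OF g] homotopy_slot_additive[OF \<eta>]
  note plus = power_sum_Mat_plus[OF a sa(1)] power_sum_Mat_plus[OF a sa(2)]
    power_sum_Mat_plus[OF a sa(3)]
  let ?G = "map_mat (bar gB) (power_sum g a)"
  have G: "?G \<in> Mat_plus m"
    using plus(2) by (auto simp: Mat_plus_def Modules.additive.zero[OF B.bar_additive])
  have "(power_sum g a - power_sum f a) $$ (i, j) = power_sum g a $$ (i, j) - power_sum f a $$ (i, j)"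
    using ij Mat_plus_carrier[OF plus(1)] by simp
  also have "\<dots> = path_sum a i j (infix_sum \<eta> (homotopy_terms f g))"
  proof (cases "i < j")
    case True
    have "path_sum a i j g = path_sum a i j (\<lambda>w. f w + (infix_sum \<eta> (homotopy_terms f g) w +
        infix_sum bA (\<lambda>us z ws. \<eta> (map (bar gA) us @ z # ws)) w))"
      using homotopy_relation_bar[OF f g \<eta>] True
      by (intro path_sum_cong) (auto simp: algebra_simps)
    then show ?thesis
      using ij True A.path_sum_insertion[OF a sa(3) closed True]
      by (auto simp: path_sum_distrib power_sum_entry[OF a] sa)
  next
    case False
    then show ?thesis
      using ij by (simp add: path_sum_homotopy_terms[OF sa a] power_sum_entry[OF a] sa)
  qed
  also have "\<dots> = mixed_sum bB ?G (power_sum \<eta> a) (power_sum f a) $$ (i, j)"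
    using ij by (simp add: path_sum_homotopy_terms[OF sa a]
        mixed_sum_entry[OF B.multilinear_b G plus(3) plus(1)])
  finally show "(power_sum g a - power_sum f a) $$ (i, j) =
      mixed_sum bB ?G (power_sum \<eta> a) (power_sum f a) $$ (i, j)" .
qed

end

section \<open>Cohomology classes\<close>

context a_infinity_algebra
begin

lemma cohomology_class_eq:
  assumes "b [x] = 0" "b [y] = 0" "y - x = b [z]"
  shows "cohomology_class b x = cohomology_class b y"
proof -
  note add = Modules.additive.add[OF b_additive] Modules.additive.diff[OF b_additive]
  have "(\<exists>u. w - x = b [u]) \<longleftrightarrow> (\<exists>u. w - y = b [u])" for w
  proof
    assume "\<exists>u. w - x = b [u]"
    then obtain u where "w - x = b [u]" ..
    then have "w - y = b [u - z]" using assms(3) by (simp add: add algebra_simps)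
    then show "\<exists>u. w - y = b [u]" ..
  next
    assume "\<exists>u. w - y = b [u]"
    then obtain u where "w - y = b [u]" ..
    then have "w - x = b [u + z]" using assms(3) by (simp add: add algebra_simps)
    then show "\<exists>u. w - x = b [u]" ..
  qed
  then show ?thesis using assms by (auto simp: cohomology_class_def cohomologous_def)
qed

lemma cohomology_class_in_cohomology: "b [x] = 0 \<Longrightarrow> cohomology_class b x \<in> cohomology b"
  by (auto simp: cohomology_def cohomology_class_def intro: quotientI)

lemma cohomology_class_self: "b [x] = 0 \<Longrightarrow> x \<in> cohomology_class b x"
  using Modules.additive.zero[OF b_additive] by (force simp: cohomology_class_def cohomologous_def)

lemma cohomology_memberE:
  assumes "\<alpha> \<in> cohomology b" "x \<in> \<alpha>"
  shows "b [x] = 0" "\<alpha> = cohomology_class b x"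
proof -
  obtain y where y: "b [y] = 0" "\<alpha> = cohomology_class b y"
    using assms(1) by (auto simp: cohomology_def cohomology_class_def quotient_def)
  then obtain z where z: "b [x] = 0" "x - y = b [z]"
    using assms(2) by (auto simp: cohomology_class_def cohomologous_def)
  show "b [x] = 0" by (fact z(1))
  show "\<alpha> = cohomology_class b x"
    unfolding y(2) using cohomology_class_eq[OF y(1) z] .
qed

end

context two_a_infinity_algebras
begin

lemma morphism_chain_map:
  assumes "a_infinity_morphism sA gA bA sB gB bB f"
  shows "f [bA [x]] = bB [f [x]]"
  using morphism_relation_bar[OF assms, of "[x]"] by simp

lemma pushforward_class:
  assumes f: "a_infinity_morphism sA gA bA sB gB bB f" and \<alpha>: "\<alpha> \<in> cohomology bA" "x \<in> \<alpha>"
  shows "bB [f [x]] = 0" "pushforward bB f \<alpha> = cohomology_class bB (f [x])"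
proof -
  have additive: "Modules.additive (\<lambda>x. f [x])"
    using slot_additiveD[OF morphism_slot_additive[OF f], of "[]" "[]"] by simp
  have closed: "bB [f [y]] = 0" if "y \<in> \<alpha>" for y
    using A.cohomology_memberE(1)[OF \<alpha>(1) that] Modules.additive.zero[OF additive]
    by (simp flip: morphism_chain_map[OF f])
  show "bB [f [x]] = 0" using closed \<alpha>(2) .
  have "cohomology_class bB (f [x]) = cohomology_class bB (f [y])" if "y \<in> \<alpha>" for y
  proof -
    have "\<exists>z. y - x = bA [z]"
      using A.cohomology_memberE(2)[OF \<alpha>] that by (auto simp: cohomology_class_def cohomologous_def)
    then obtain z where "y - x = bA [z]" ..
    then have "f [y] - f [x] = bB [f [z]]"
      by (simp add: Modules.additive.diff[OF additive, symmetric] morphism_chain_map[OF f])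
    then show ?thesis
      by (rule B.cohomology_class_eq[OF closed[OF \<alpha>(2)] closed[OF that]])
  qed
  then show "pushforward bB f \<alpha> = cohomology_class bB (f [x])"
    unfolding pushforward_def using \<alpha>(2) by blast
qed

text \<open>
  This is the homotopy relation for words of length one, \<open>g [x] - f [x] = bB [\<eta> [x]] + \<eta> [bA [x]]\<close>.  It
  applies to the entries next to the diagonal of \<open>a\<close> and to the Massey cocycle alike.
\<close>

lemma homotopic_classes:
  assumes f: "a_infinity_morphism sA gA bA sB gB bB f"
    and g: "a_infinity_morphism sA gA bA sB gB bB g"
    and \<eta>: "a_infinity_homotopy sA gA bA sB gB bB f g \<eta>" and x: "bA [x] = 0"
  shows "cohomology_class bB (f [x]) = cohomology_class bB (g [x])"
proof (rule B.cohomology_class_eq)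
  have zero: "h [0] = 0" if "slot_additive h" for h :: "'a list \<Rightarrow> 'b"
    using slot_additive_zero[OF that] by simp
  show "bB [f [x]] = 0" "bB [g [x]] = 0"
    using x f g by (simp_all add: zero morphism_slot_additive flip: morphism_chain_map)
  show "g [x] - f [x] = bB [\<eta> [x]]"
    using homotopy_relation_bar[OF f g \<eta>, of "[x]"] x zero[OF homotopy_slot_additive[OF \<eta>]]
    by (simp add: homotopy_terms_def)
qed

lemma defining_system_morphism:
  assumes f: "a_infinity_morphism sA gA bA sB gB bB f" and a: "defining_system m bA \<alpha> a"
  shows "defining_system m bB (\<lambda>i. pushforward bB f (\<alpha> i)) (power_sum f a)"
proof -
  note sa = morphism_slot_additive[OF f]
  have plus: "a \<in> Mat_plus m" and closed: "approx m (power_sum bA a) (0\<^sub>m (m + 1) (m + 1))"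
    using a by (auto simp: defining_system_def)
  note plusF = power_sum_Mat_plus[OF plus sa]
  have "power_sum bB (power_sum f a) $$ (i, j) = 0" if "i \<le> m" "j \<le> m" "(i, j) \<noteq> (0, m)" for i j
    using that power_sum_morphism[OF f plus closed, of i j]
    by (cases "i < j") (auto simp: power_sum_entry[OF plusF B.slot_additive_b])
  moreover have "pushforward bB f (\<alpha> i) \<in> cohomology bB \<and>
      power_sum f a $$ (i - 1, i) \<in> pushforward bB f (\<alpha> i)" if i: "i \<in> {1..m}" for i
  proof -
    have "\<alpha> i \<in> cohomology bA" "a $$ (i - 1, i) \<in> \<alpha> i"
      using a i by (auto simp: defining_system_def)
    note pushed = pushforward_class[OF f this]
    obtain k where k: "i = Suc k" using i by (cases i) auto
    have "{k<..Suc k} = {Suc k}" by auto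
    then have "power_sum f a $$ (i - 1, i) = f [a $$ (i - 1, i)]"
      using i unfolding k by (simp add: power_sum_entry[OF plus sa] path_sum_less)
    then show ?thesis
      using pushed B.cohomology_class_in_cohomology B.cohomology_class_self by simp
  qed
  ultimately show ?thesis
    using plusF by (auto simp: defining_system_def approx_def)
qed

end

theorem theorem4p18:
  fixes sA :: "'k::field \<Rightarrow> 'a::ab_group_add \<Rightarrow> 'a"
    and sB :: "'k \<Rightarrow> 'b::ab_group_add \<Rightarrow> 'b"
    and gA :: "'d::ring_parity \<Rightarrow> 'a set"
    and gB :: "'d \<Rightarrow> 'b set"
    and bA :: "'a list \<Rightarrow> 'a"
    and bB :: "'b list \<Rightarrow> 'b"
    and f g \<eta> :: "'a list \<Rightarrow> 'b"
    and m :: nat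
    and \<alpha> :: "nat \<Rightarrow> 'a set"
    and a :: "'a mat"
  assumes "a_infinity_algebra sA gA bA"
    and "a_infinity_algebra sB gB bB"
    and "a_infinity_morphism sA gA bA sB gB bB f"
    and "a_infinity_morphism sA gA bA sB gB bB g"
    and "a_infinity_homotopy sA gA bA sB gB bB f g \<eta>"
    and "m \<ge> 2"
    and "defining_system m bA \<alpha> a"
  shows "(\<forall>i\<in>{1..m}. pushforward bB f (\<alpha> i) = pushforward bB g (\<alpha> i)) \<and>
    equivalent_defining_systems m gB bB (\<lambda>i. pushforward bB f (\<alpha> i))
      (power_sum f a) (power_sum g a) \<and>
    cohomology_class bB (massey_cocycle m bB (power_sum f a)) \<in> cohomology bB \<and>
    cohomology_class bB (massey_cocycle m bB (power_sum f a)) =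
      cohomology_class bB (massey_cocycle m bB (power_sum g a))"
proof (intro conjI)
  interpret two_a_infinity_algebras sA gA bA sB gB bB
    using assms(1,2) by (intro two_a_infinity_algebras.intro)
  note f = assms(3) and g = assms(4) and \<eta> = assms(5)
  have a: "a \<in> Mat_plus m" and closed: "approx m (power_sum bA a) (0\<^sub>m (m + 1) (m + 1))"
    using assms(7) by (auto simp: defining_system_def)
  let ?\<mu> = "massey_cocycle m bA a"
  have \<mu>: "bA [?\<mu>] = 0" using A.massey_cocycle_closed[OF a closed] assms(6) by simp
  have \<mu>_image: "massey_cocycle m bB (power_sum f a) = f [?\<mu>]"
      "massey_cocycle m bB (power_sum g a) = g [?\<mu>]"
    using massey_cocycle_morphism[OF _ a closed] f g assms(6) by auto
  show classes: "\<forall>i\<in>{1..m}. pushforward bB f (\<alpha> i) = pushforward bB g (\<alpha> i)"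
  proof
    fix i assume "i \<in> {1..m}"
    then have \<alpha>: "\<alpha> i \<in> cohomology bA" "a $$ (i - 1, i) \<in> \<alpha> i"
      using assms(7) by (auto simp: defining_system_def)
    then show "pushforward bB f (\<alpha> i) = pushforward bB g (\<alpha> i)"
      using homotopic_classes[OF f g \<eta> A.cohomology_memberE(1)[OF \<alpha>]]
      by (simp add: pushforward_class[OF f] pushforward_class[OF g])
  qed
  have "defining_system m bB (\<lambda>i. pushforward bB f (\<alpha> i)) (power_sum g a)"
    using defining_system_morphism[OF g assms(7)] classes by (simp add: defining_system_def)
  then show "equivalent_defining_systems m gB bB (\<lambda>i. pushforward bB f (\<alpha> i))
      (power_sum f a) (power_sum g a)"
    using defining_system_morphism[OF f assms(7)] power_sum_homotopy[OF f g \<eta> a closed]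
      power_sum_Mat_plus[OF a homotopy_slot_additive[OF \<eta>]]
    by (auto simp: equivalent_defining_systems_def)
  show "cohomology_class bB (massey_cocycle m bB (power_sum f a)) =
      cohomology_class bB (massey_cocycle m bB (power_sum g a))"
    unfolding \<mu>_image by (rule homotopic_classes[OF f g \<eta> \<mu>])
  have "bB [f [?\<mu>]] = 0"
    using \<mu> slot_additive_zero[OF morphism_slot_additive[OF f]] by (simp flip: morphism_chain_map[OF f])
  then show "cohomology_class bB (massey_cocycle m bB (power_sum f a)) \<in> cohomology bB"
    unfolding \<mu>_image by (rule B.cohomology_class_in_cohomology)
qed

end
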